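(* There is an absolute constant $C>0$ such that for every integer $q \geq 3$, $$\left|\sum_{\substack{\chi \bmod q\\ \chi \neq \chi_0}} |L(1, \chi)|^4 \;-\; \phi(q) \sum_{\substack{n=1 \\ (n, q)=1}}^{q} \frac{d^2(n)}{n^2}\right| \;\leq\; C\,\frac{\phi(q)}{\sqrt{q}} \log^4(q+2),$$ where the sum on the left runs over all Dirichlet characters $\chi$ modulo $q$ other than the principal character $\chi_0$.
   Context: For a Dirichlet character $\chi \bmod q$, $L(s,\chi)$ denotes the Dirichlet $L$-series $\sum_{n\ge1}\chi(n)n^{-s}$ (for $\operatorname{Re} s>1$) and its analytic continuation; for $\chi\neq\chi_0$ it is entire, so $L(1,\chi)$ is defined. $\chi_0$ is the principal character modulo $q$, $\phi$ is Euler's totient function, and $d(n)$ is the number of positive divisors of $n$. *)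

theory Defs
  imports "HOL-Complex_Analysis.Complex_Analysis" "HOL-Number_Theory.Number_Theory"
begin

text \<open>
  Dirichlet characters modulo \<open>q\<close> are extended by zero to integers not coprime to \<open>q\<close>.
  By periodicity they are determined by their values on the natural numbers, so the latter
  are used as domain. Note that \<open>chi 1 = 1\<close> follows from multiplicativity and \<open>chi 1 \<noteq> 0\<close>.
\<close>

definition dirichlet_character :: "nat \<Rightarrow> (nat \<Rightarrow> complex) \<Rightarrow> bool" where
  "dirichlet_character q chi \<longleftrightarrow>
     (\<forall>m n. chi (m * n) = chi m * chi n) \<and>
     (\<forall>n. chi (n + q) = chi n) \<and>
     (\<forall>n. chi n \<noteq> 0 \<longleftrightarrow> coprime n q)"

definition principal_character :: "nat \<Rightarrow> nat \<Rightarrow> complex" where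
  "principal_character q n = (if coprime n q then 1 else 0)"

text \<open>
  The analytic continuation of \<open>\<Sum>n\<ge>1. chi(n) n\<^sup>-\<^sup>s\<close> from \<open>Re s > 1\<close>: to the whole plane
  for non-principal \<open>chi\<close>, and to the plane without the pole \<open>s = 1\<close> for the principal one.
  The function is unique on that domain by the identity theorem; its value at the pole is arbitrary.
\<close>

definition dirichlet_L :: "nat \<Rightarrow> (nat \<Rightarrow> complex) \<Rightarrow> complex \<Rightarrow> complex" where
  "dirichlet_L q chi =
     (SOME f. f holomorphic_on (if chi = principal_character q then - {1} else UNIV) \<and>
              (\<forall>s. Re s > 1 \<longrightarrow> f s = (\<Sum>n. chi (Suc n) / of_nat (Suc n) powr s)))"

definition divisor_count :: "nat \<Rightarrow> nat" where
  "divisor_count n = card {d. d dvd n}"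

end

theory Submission
  imports Defs
begin

text \<open>
  Let \<open>N = q\<^sup>2\<close> and \<open>S(chi) = \<Sum>n\<le>N. chi(n)/n\<close>. Since the sums of a non-principal character over
  intervals are at most \<open>q\<close>, partial summation gives \<open>L(1, chi) = S(chi) + O(1/q)\<close>. By orthogonality
  the sum of \<open>\<bar>S(chi)\<bar>^4\<close> over all characters is \<open>\<phi>(q)\<close> times the sum of \<open>1/(abcd)\<close> over
  \<open>a b \<equiv> c d (mod q)\<close>. The quadruples with \<open>a b = c d \<le> q\<close> contribute exactly the main term.
  In all others one variable, say \<open>a\<close>, exceeds \<open>sqrt q\<close>; given the other three, \<open>a\<close> is confined to
  one residue class, so the sum over \<open>a\<close> is \<open>O(log N / sqrt q)\<close>, and the other three variables cost
  a factor \<open>log N\<close> each. The principal character contributes \<open>O(log\<^sup>4 N)\<close>, which is admissible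
  because \<open>2 \<phi>(q)\<^sup>2 \<ge> q\<close>.

  The entire continuation of \<open>L(s, chi)\<close> is obtained by repeated partial summation: each step
  replaces the periodic mean-zero coefficients by a periodic mean-zero antidifference and
  \<open>n\<^sup>-\<^sup>s\<close> by its difference in \<open>n\<close>, which gains one power of \<open>n\<close>.
\<close>

section \<open>Dirichlet characters and orthogonality\<close>

lemma dirichlet_character_cong:
  assumes "dirichlet_character q chi" "[m = n] (mod q)"
  shows "chi m = chi n"
proof -
  have "chi (n + k * q) = chi n" for n k
  proof (induction k)
    case (Suc k)
    have "chi (n + k * q + q) = chi (n + k * q)"
      using assms(1) by (simp only: dirichlet_character_def)
    with Suc show ?case by (simp add: ac_simps)
  qed simp
  hence "chi (n mod q) = chi n" for n
    by (metis mod_div_mult_eq)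
  with assms(2) show ?thesis by (metis cong_def)
qed

lemma dirichlet_character_mult:
  "dirichlet_character q chi \<Longrightarrow> chi (m * n) = chi m * chi n"
  by (simp add: dirichlet_character_def)

lemma dirichlet_character_eq_0_iff:
  "dirichlet_character q chi \<Longrightarrow> chi n = 0 \<longleftrightarrow> \<not> coprime n q"
  by (auto simp: dirichlet_character_def)

lemma dirichlet_character_1:
  assumes "dirichlet_character q chi"
  shows "chi (Suc 0) = 1"
  using dirichlet_character_mult[OF assms, of 1 1] dirichlet_character_eq_0_iff[OF assms, of 1]
  by simp

lemma dirichlet_character_power:
  assumes "dirichlet_character q chi"
  shows "chi (n ^ k) = chi n ^ k"
  by (induction k) (simp_all add: dirichlet_character_1[OF assms] dirichlet_character_mult[OF assms])

lemma dirichlet_character_power_totient: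
  assumes "dirichlet_character q chi" "coprime n q"
  shows "chi n ^ totient q = 1"
  using dirichlet_character_power[OF assms(1), of n "totient q"]
    dirichlet_character_cong[OF assms(1) euler_theorem[OF assms(2)]] dirichlet_character_1[OF assms(1)]
  by simp

lemma norm_dirichlet_character:
  assumes "dirichlet_character q chi" "q > 0"
  shows "norm (chi n) = (if coprime n q then 1 else 0)"
proof (cases "coprime n q")
  case True
  have "norm (chi n) ^ totient q = 1"
    by (metis True assms(1) dirichlet_character_power_totient norm_one norm_power)
  hence "norm (chi n) = 1"
    using assms(2) power_eq_imp_eq_base[of "norm (chi n)" "totient q" 1] by simp
  with True show ?thesis by simp
next
  case False
  with dirichlet_character_eq_0_iff[OF assms(1)] show ?thesis by simp
qed

lemma dirichlet_character_principal: "dirichlet_character q (principal_character q)"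
proof -
  have "coprime (n + q) q \<longleftrightarrow> coprime n q" for n
    by (simp only: coprime_iff_gcd_eq_1 gcd_add1)
  thus ?thesis by (simp add: dirichlet_character_def principal_character_def)
qed

lemma dirichlet_character_times:
  assumes "dirichlet_character q chi" "dirichlet_character q psi"
  shows "dirichlet_character q (\<lambda>n. chi n * psi n)"
  using assms unfolding dirichlet_character_def by (simp add: mult_ac)

lemma dirichlet_character_cnj:
  "dirichlet_character q chi \<Longrightarrow> dirichlet_character q (\<lambda>n. cnj (chi n))"
  unfolding dirichlet_character_def by simp

text \<open>By periodicity a character is given by its values below \<open>q\<close>, and each value
  is zero or a root of unity of order dividing \<open>totient q\<close>, so there are finitely many
  candidates.\<close>

lemma finite_dirichlet_characters:
  assumes "q > 0"
  shows "finite {chi. dirichlet_character q chi}"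
proof -
  define R where "R = insert 0 {z::complex. z ^ totient q = 1}"
  have "finite R"
    unfolding R_def using assms finite_roots_unity[of "totient q"] by (simp add: Suc_le_eq)
  hence "finite ((\<lambda>g n. g (n mod q)) ` ({..<q} \<rightarrow>\<^sub>E R))"
    by (intro finite_imageI finite_PiE) auto
  moreover have "{chi. dirichlet_character q chi} \<subseteq> (\<lambda>g n. g (n mod q)) ` ({..<q} \<rightarrow>\<^sub>E R)"
  proof
    fix chi assume "chi \<in> {chi. dirichlet_character q chi}"
    hence chi: "dirichlet_character q chi" by simp
    have "chi = (\<lambda>n. restrict chi {..<q} (n mod q))"
    proof
      fix n
      have "chi n = chi (n mod q)" by (rule dirichlet_character_cong[OF chi]) (simp add: cong_def)
      thus "chi n = restrict chi {..<q} (n mod q)" using assms by simp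
    qed
    moreover have "restrict chi {..<q} \<in> {..<q} \<rightarrow>\<^sub>E R"
      using dirichlet_character_power_totient[OF chi] dirichlet_character_eq_0_iff[OF chi]
      by (auto simp: R_def)
    ultimately show "chi \<in> (\<lambda>g n. g (n mod q)) ` ({..<q} \<rightarrow>\<^sub>E R)"
      by blast
  qed
  ultimately show ?thesis by (rule finite_subset[rotated])
qed

lemma bij_betw_mult_mod:
  assumes "coprime a q" "q > (0::nat)"
  shows "bij_betw (\<lambda>n. a * n mod q) {..<q} {..<q}"
proof -
  have "inj_on (\<lambda>n. a * n mod q) {..<q}"
  proof (rule inj_onI)
    fix x y assume "x \<in> {..<q}" "y \<in> {..<q}" "a * x mod q = a * y mod q"
    thus "x = y"
      using cong_mult_lcancel_nat[OF assms(1), of x y] by (simp add: cong_def)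
  qed
  moreover have "(\<lambda>n. a * n mod q) ` {..<q} \<subseteq> {..<q}"
    using assms by auto
  ultimately show ?thesis
    by (simp add: bij_betw_def endo_inj_surj)
qed

text \<open>For a non-principal character some unit \<open>a\<close> has
  \<open>chi a \<noteq> 1\<close>. Multiplication by \<open>a\<close> permutes the residues and
  multiplies the sum by \<open>chi a\<close>, so the sum vanishes.\<close>

lemma sum_dirichlet_character_residues:
  assumes chi: "dirichlet_character q chi" and q: "q > 0"
  shows "(\<Sum>n<q. chi n) = (if chi = principal_character q then of_nat (totient q) else 0)"
proof (cases "chi = principal_character q")
  case True
  have "(\<Sum>n<q. chi n) = of_nat (card {n\<in>{..<q}. coprime n q})"
    using True by (simp add: principal_character_def sum.If_cases Int_def)
  also have "{n\<in>{..<q}. coprime n q} = {n. n < q \<and> coprime n q}"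
    by auto
  also have "card \<dots> = totient q"
  \<comment> \<open>For \<open>q = 1\<close> the sets differ: the residue below \<open>q\<close> is
    0, the totative is 1. Only the cardinalities agree.\<close>
  proof (cases "q = 1")
    case False
    hence "{n. n < q \<and> coprime n q} = totatives q"
      using q by (auto simp: totatives_def le_less intro!: Nat.gr0I)
    thus ?thesis by (simp add: totient_def)
  qed (auto simp: card_1_singleton_iff)
  finally show ?thesis using True by simp
next
  case False
  have "\<exists>a. coprime a q \<and> chi a \<noteq> 1"
  proof (rule ccontr)
    assume "\<not> ?thesis"
    hence "chi n = principal_character q n" for n
      using dirichlet_character_eq_0_iff[OF chi, of n] by (auto simp: principal_character_def)
    with False show False by auto
  qed
  then obtain a where a: "coprime a q" "chi a \<noteq> 1" by blast
  have "(\<Sum>n<q. chi n) = (\<Sum>n<q. chi (a * n mod q))"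
    using sum.reindex_bij_betw[OF bij_betw_mult_mod[OF a(1) q], of chi] by simp
  also have "\<dots> = (\<Sum>n<q. chi a * chi n)"
    by (intro sum.cong refl, subst dirichlet_character_mult[OF chi, symmetric])
       (auto intro: dirichlet_character_cong[OF chi] simp: cong_def)
  also have "\<dots> = chi a * (\<Sum>n<q. chi n)"
    by (simp add: sum_distrib_left)
  finally have "(1 - chi a) * (\<Sum>n<q. chi n) = 0"
    by (simp add: ring_distribs)
  with a(2) False show ?thesis by simp
qed

section \<open>Construction of characters as joint eigenfunctions of dilations\<close>

lemma sum_roots_unity_power:
  assumes "j < m"
  shows "(\<Sum>z | z ^ m = (1::complex). z ^ j) = (if j = 0 then of_nat m else 0)"
proof (cases "j = 0")
  case True
  have "card {z::complex. z ^ m = 1} = m"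
    using assms by (intro card_complex_roots_unity) auto
  with True show ?thesis by simp
next
  case False
  define w where "w = exp (2 * of_real pi * \<i> * of_nat 1 / of_nat m)"
  have w: "w ^ m = 1"
    unfolding w_def using assms by (intro complex_root_unity) auto
  have wz: "w \<noteq> 0" by (simp add: w_def)
  have "w ^ j = exp (2 * of_real pi * \<i> * of_nat j / of_nat m)"
    unfolding w_def by (simp add: exp_of_nat_mult [symmetric] field_simps)
  hence wj: "w ^ j \<noteq> 1"
    using complex_root_unity_eq_1[of m j] assms False by (auto dest: dvd_imp_le)
  have "bij_betw ((*) w) {z. z ^ m = 1} {z. z ^ m = 1}"
    using w assms wz
    by (intro bij_betwI[where g = "\<lambda>z. z / w"]) (auto simp: power_mult_distrib power_divide)
  hence "(\<Sum>z | z ^ m = 1. z ^ j) = (\<Sum>z | z ^ m = 1. (w * z) ^ j)"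
    by (rule sum.reindex_bij_betw[symmetric])
  also have "\<dots> = w ^ j * (\<Sum>z | z ^ m = 1. z ^ j)"
    by (simp add: power_mult_distrib sum_distrib_left)
  finally have "(1 - w ^ j) * (\<Sum>z | z ^ m = 1. z ^ j) = 0"
    by (simp add: ring_distribs)
  with wj False show ?thesis by simp
qed

text \<open>If \<open>z ^ m = 1\<close> and \<open>f\<close> is invariant under dilation by
  \<open>g ^ m\<close>, this is \<open>m\<close> times the spectral projection of \<open>f\<close>
  onto the eigenspace of the dilation by \<open>g\<close> with eigenvalue
  \<open>inverse z\<close>.\<close>

definition eigenprojection :: "nat \<Rightarrow> nat \<Rightarrow> complex \<Rightarrow> (nat \<Rightarrow> complex) \<Rightarrow> nat \<Rightarrow> complex" where
  "eigenprojection m g z f x = (\<Sum>j<m. z ^ j * f (g ^ j * x))"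

text \<open>Summing over \<open>z\<close> kills every term except \<open>j = 0\<close>. Hence a
  function that is nonzero at \<open>x\<close> has some projection that is nonzero at
  \<open>x\<close>.\<close>

lemma sum_eigenprojection:
  assumes "m > 0"
  shows "(\<Sum>z | z ^ m = 1. eigenprojection m g z f x) = of_nat m * f x"
proof -
  have "(\<Sum>z | z ^ m = 1. eigenprojection m g z f x) =
          (\<Sum>j<m. (\<Sum>z | z ^ m = 1. z ^ j) * f (g ^ j * x))"
    unfolding eigenprojection_def by (subst sum.swap) (simp add: sum_distrib_right)
  also have "\<dots> = (\<Sum>j<m. if j = 0 then of_nat m * f x else 0)"
    by (intro sum.cong) (auto simp: sum_roots_unity_power)
  finally show ?thesis using assms by simp
qed

text \<open>Multiplication by \<open>z\<close> shifts the summation index by one, and the sum closes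
  up cyclically because the terms for \<open>j = m\<close> and \<open>j = 0\<close>
  coincide.\<close>

lemma eigenprojection_mult:
  assumes "z ^ m = 1" "\<And>x. f (g ^ m * x) = f x" "m > 0"
  shows "eigenprojection m g z f (g * x) = inverse z * eigenprojection m g z f x"
proof -
  have "z * eigenprojection m g z f (g * x) = (\<Sum>j<m. z ^ Suc j * f (g ^ Suc j * x))"
    unfolding eigenprojection_def by (simp add: sum_distrib_left ac_simps)
  \<comment> \<open>The added \<open>f x\<close> is the missing term \<open>j = 0\<close> of the
    shifted sum; it cancels against the term \<open>j = m\<close> below.\<close>
  also have "f x + \<dots> = (\<Sum>j<Suc m. z ^ j * f (g ^ j * x))"
    by (subst sum.lessThan_Suc_shift) simp
  also have "\<dots> = eigenprojection m g z f x + f x"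
    using assms by (simp add: eigenprojection_def)
  finally have "z * eigenprojection m g z f (g * x) = eigenprojection m g z f x"
    by simp
  moreover have "z \<noteq> 0" using assms(1,3) by (cases "z = 0") (auto simp: power_0_left)
  ultimately show ?thesis by (simp add: field_simps)
qed

text \<open>These are the functions on the unit group modulo \<open>q\<close>, extended by zero: the
  space on which the commuting dilations by units act.\<close>

definition periodic_on_units :: "nat \<Rightarrow> (nat \<Rightarrow> complex) \<Rightarrow> bool" where
  "periodic_on_units q f \<longleftrightarrow>
     (\<forall>x y. [x = y] (mod q) \<longrightarrow> f x = f y) \<and> (\<forall>x. f x \<noteq> 0 \<longrightarrow> coprime x q)"

lemma periodic_on_units_cong: "periodic_on_units q f \<Longrightarrow> [x = y] (mod q) \<Longrightarrow> f x = f y"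
  and periodic_on_units_coprime: "periodic_on_units q f \<Longrightarrow> f x \<noteq> 0 \<Longrightarrow> coprime x q"
  unfolding periodic_on_units_def by blast+

lemma periodic_on_units_eigenprojection:
  assumes "periodic_on_units q f"
  shows "periodic_on_units q (eigenprojection m g z f)"
proof -
  have "eigenprojection m g z f x = eigenprojection m g z f y" if "[x = y] (mod q)" for x y
    unfolding eigenprojection_def
    by (intro sum.cong refl arg_cong2[where f = "(*)"] periodic_on_units_cong[OF assms]
          cong_scalar_left that)
  moreover have "eigenprojection m g z f x = 0" if "\<not> coprime x q" for x
    unfolding eigenprojection_def
    using periodic_on_units_coprime[OF assms] that by (intro sum.neutral) force
  ultimately show ?thesis unfolding periodic_on_units_def by blast
qed

lemma periodic_on_units_totient:
  assumes "periodic_on_units q f" "coprime g q"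
  shows "f (g ^ totient q * x) = f x"
  using periodic_on_units_cong[OF assms(1) cong_scalar_right[OF euler_theorem[OF assms(2)], of x]]
  by simp

text \<open>Dilations commute, so projecting onto an eigenspace of one keeps the eigenvalues of the others.\<close>

lemma exists_joint_eigenfunction:
  assumes "finite T" "\<And>g. g \<in> T \<Longrightarrow> coprime g q" "q > 0"
      and "periodic_on_units q f" "f x0 \<noteq> 0"
  shows "\<exists>f'. periodic_on_units q f' \<and> (\<exists>x. f' x \<noteq> 0) \<and>
           (\<forall>h c. (\<forall>x. f (h * x) = c * f x) \<longrightarrow> (\<forall>x. f' (h * x) = c * f' x)) \<and>
           (\<forall>g\<in>T. \<exists>c. \<forall>x. f' (g * x) = c * f' x)"
  using assms(1,2)
proof (induction T rule: finite_induct)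
  case empty
  show ?case using assms(4,5) by (intro exI[of _ f]) auto
next
  case (insert g T)
  have "\<exists>f'. periodic_on_units q f' \<and> (\<exists>x. f' x \<noteq> 0) \<and>
           (\<forall>h c. (\<forall>x. f (h * x) = c * f x) \<longrightarrow> (\<forall>x. f' (h * x) = c * f' x)) \<and>
           (\<forall>g\<in>T. \<exists>c. \<forall>x. f' (g * x) = c * f' x)"
    by (intro insert.IH insert.prems) simp
  then obtain f' where IH: "periodic_on_units q f'" "\<exists>x. f' x \<noteq> 0"
    "\<forall>h c. (\<forall>x. f (h * x) = c * f x) \<longrightarrow> (\<forall>x. f' (h * x) = c * f' x)"
    "\<forall>g\<in>T. \<exists>c. \<forall>x. f' (g * x) = c * f' x"
    by - (erule exE, (erule conjE)+, rule that)
  from IH(2) obtain x where x: "f' x \<noteq> 0" by (elim exE)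
  define m where "m = totient q"
  have m: "m > 0" using assms(3) by (simp add: m_def)
  \<comment> \<open>The projections add up to \<open>m * f' x\<close>, so at least one of them
    survives at \<open>x\<close>; it becomes the new function.\<close>
  have "(\<Sum>z | z ^ m = 1. eigenprojection m g z f' x) \<noteq> 0"
    using sum_eigenprojection[OF m, of g f' x] x m by simp
  then obtain z where z: "z ^ m = 1" "eigenprojection m g z f' x \<noteq> 0"
    by (metis (mono_tags, lifting) mem_Collect_eq sum.neutral)
  have keep: "eigenprojection m g z f' (h * y) = c * eigenprojection m g z f' y"
    if "\<And>y. f' (h * y) = c * f' y" for h c y
    unfolding eigenprojection_def sum_distrib_left
    using that by (intro sum.cong refl) (simp add: mult.left_commute[of _ h])
  have new: "eigenprojection m g z f' (g * y) = inverse z * eigenprojection m g z f' y" for y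
    using z(1) m insert.prems IH(1) unfolding m_def
    by (intro eigenprojection_mult periodic_on_units_totient) auto
  show ?case
  proof (intro exI[of _ "eigenprojection m g z f'"] conjI allI impI ballI)
    show "periodic_on_units q (eigenprojection m g z f')"
      by (rule periodic_on_units_eigenprojection[OF IH(1)])
    show "\<exists>x. eigenprojection m g z f' x \<noteq> 0" using z(2) by blast
    show "eigenprojection m g z f' (h * y) = c * eigenprojection m g z f' y"
      if "\<forall>x. f (h * x) = c * f x" for h c y
      by (rule keep) (use that IH(3) in simp)
    show "\<exists>c. \<forall>y. eigenprojection m g z f' (h * y) = c * eigenprojection m g z f' y"
      if "h \<in> insert g T" for h
    proof (cases "h = g")
      case False
      with that IH(4) obtain c where "\<And>y. f' (h * y) = c * f' y" by auto
      hence "eigenprojection m g z f' (h * y) = c * eigenprojection m g z f' y" for y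
        by (rule keep)
      thus ?thesis by blast
    qed (use new in blast)
  qed
qed

text \<open>Evaluating the eigenvalue equation at 1 shows that the eigenvalue for \<open>g\<close>
  is \<open>f g / f 1\<close>. After this normalisation the equation itself is
  multiplicativity.\<close>

lemma dirichlet_character_of_eigenfunction:
  assumes f: "periodic_on_units q f" "f x0 \<noteq> 0" and q: "q > 0"
      and ev: "\<And>g. coprime g q \<Longrightarrow> \<exists>c. \<forall>x. f (g * x) = c * f x"
  shows "dirichlet_character q (\<lambda>n. f n / f 1)"
proof -
  \<comment> \<open>The point \<open>x0\<close> is a unit since \<open>f x0\<close> is nonzero, and
    \<open>f x0\<close> is a multiple of \<open>f 1\<close>.\<close>
  have "f 1 \<noteq> 0"
    using ev[of x0] f(2) periodic_on_units_coprime[OF f] by (metis mult.right_neutral mult_zero_right)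
  define chi where "chi = (\<lambda>n. f n / f 1)"
  have mult: "chi (g * x) = chi g * chi x" for g x
  proof (cases "coprime g q")
    case True
    then obtain c where c: "\<And>x. f (g * x) = c * f x" using ev by blast
    show ?thesis using c[of x] c[of 1] \<open>f 1 \<noteq> 0\<close> by (simp add: chi_def)
  next
    case False
    hence "f g = 0" "f (g * x) = 0" using periodic_on_units_coprime[OF f(1)] by force+
    thus ?thesis by (simp add: chi_def)
  qed
  have per: "chi m = chi n" if "[m = n] (mod q)" for m n
    using periodic_on_units_cong[OF f(1) that] by (simp add: chi_def)
  \<comment> \<open>By Euler's theorem \<open>chi n\<close> is a factor of
    \<open>chi 1 = 1\<close>.\<close>
  have "chi n \<noteq> 0" if "coprime n q" for n
  proof -
    have "chi (n ^ totient q) = chi 1" by (intro per euler_theorem that)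
    also have "n ^ totient q = n * n ^ (totient q - 1)"
      using q by (simp add: power_eq_if)
    also have "chi \<dots> = chi n * chi (n ^ (totient q - 1))" by (rule mult)
    finally show ?thesis using \<open>f 1 \<noteq> 0\<close> by (auto simp: chi_def)
  qed
  moreover have "coprime n q" if "chi n \<noteq> 0" for n
    using that periodic_on_units_coprime[OF f(1), of n] by (auto simp: chi_def)
  ultimately have "dirichlet_character q chi"
    unfolding dirichlet_character_def using mult by (auto intro: per simp: cong_def)
  thus ?thesis by (simp add: chi_def)
qed

text \<open>Start from the indicator of the class of 1. It is not invariant under dilation by
  \<open>a\<close>, so it has a nonzero component for an eigenvalue other than 1. A joint
  eigenfunction built from this component keeps that eigenvalue, which is then
  \<open>chi a\<close>.\<close>

lemma dirichlet_character_separates: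
  assumes a: "coprime a q" "\<not> [a = 1] (mod q)" and q: "q > 0"
  obtains chi where "dirichlet_character q chi" "chi a \<noteq> 1"
proof -
  define f where "f x = (if [x = 1] (mod q) then 1 else 0 :: complex)" for x
  have f: "periodic_on_units q f"
    unfolding periodic_on_units_def f_def
    using cong_imp_coprime[of 1 _ q] by (auto intro: cong_trans cong_sym)
  define m where "m = totient q"
  have m: "m > 0" using q by (simp add: m_def)
  have "\<exists>z x. z ^ m = 1 \<and> z \<noteq> 1 \<and> eigenprojection m a z f x \<noteq> 0"
  proof (rule ccontr)
    assume "\<not> ?thesis"
    hence "(\<Sum>z | z ^ m = 1. eigenprojection m a z f x) = (\<Sum>z\<in>{1}. eigenprojection m a z f x)" for x
      using m finite_roots_unity[of m] by (intro sum.mono_neutral_right) auto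
    hence "of_nat m * f x = eigenprojection m a 1 f x" for x
      by (simp add: sum_eigenprojection[OF m])
    moreover have "eigenprojection m a 1 f (a * 1) = inverse 1 * eigenprojection m a 1 f 1"
      using m periodic_on_units_totient[OF f a(1)]
      by (intro eigenprojection_mult) (auto simp: m_def)
    ultimately have "of_nat m * f a = of_nat m * f 1"
      by (metis inverse_1 mult.right_neutral mult_1)
    hence "f a = f 1" using m by simp
    with a(2) show False by (auto simp: f_def)
  qed
  then obtain z x where z: "z ^ m = 1" "z \<noteq> 1" "eigenprojection m a z f x \<noteq> 0"
    by blast
  have az: "eigenprojection m a z f (a * x) = inverse z * eigenprojection m a z f x" for x
    using z(1) m periodic_on_units_totient[OF f a(1)]
    by (intro eigenprojection_mult) (auto simp: m_def)
  have "finite {g. g < q \<and> coprime g q}" by simp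
  from exists_joint_eigenfunction[OF this _ q periodic_on_units_eigenprojection[OF f] z(3)]
  obtain F where F: "periodic_on_units q F" "\<exists>y. F y \<noteq> 0"
    "\<forall>h c. (\<forall>x. eigenprojection m a z f (h * x) = c * eigenprojection m a z f x) \<longrightarrow>
       (\<forall>x. F (h * x) = c * F x)"
    "\<forall>g\<in>{g. g < q \<and> coprime g q}. \<exists>c. \<forall>x. F (g * x) = c * F x"
    using az
    by - (drule meta_mp, simp, erule exE, (erule conjE)+, rule that)
  from F(2) obtain y where y: "F y \<noteq> 0" by (elim exE)
  have Fa: "F (a * x) = inverse z * F x" for x using F(3) az by blast
  \<comment> \<open>The joint eigenfunction was built for the finitely many units below
    \<open>q\<close>; periodicity extends the relation to all units.\<close>
  have "\<exists>c. \<forall>x. F (g * x) = c * F x" if "coprime g q" for g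
  proof -
    have "coprime (g mod q) q" "g mod q < q" using that q by auto
    then obtain c where c: "\<And>x. F ((g mod q) * x) = c * F x" using F(4) by blast
    have "F (g * x) = F ((g mod q) * x)" for x
      by (intro periodic_on_units_cong[OF F(1)]) (simp add: cong_def mod_mult_left_eq)
    thus ?thesis using c by auto
  qed
  from dirichlet_character_of_eigenfunction[OF F(1) y q this]
  have chi: "dirichlet_character q (\<lambda>n. F n / F 1)" .
  have "F 1 \<noteq> 0" using dirichlet_character_1[OF chi] by auto
  hence "F a / F 1 = inverse z" using Fa[of 1] by simp
  with z(2) have "F a / F 1 \<noteq> 1" by simp
  with chi show ?thesis by (rule that)
qed

text \<open>Away from the class of 1, multiplying all characters by one that separates
  \<open>a\<close> from 1 permutes them and scales the sum by a factor other than 1. In the class of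
  1 the sum is the number of characters, which double counting identifies.\<close>

lemma sum_over_dirichlet_characters:
  assumes q: "q > 0"
  shows "(\<Sum>chi | dirichlet_character q chi. chi a) =
           (if [a = 1] (mod q) then of_nat (totient q) else 0)"
proof -
  let ?X = "{chi. dirichlet_character q chi}"
  have nontriv: "(\<Sum>chi\<in>?X. chi a) = 0" if a: "\<not> [a = 1] (mod q)" for a
  proof (cases "coprime a q")
    case True
    then obtain psi where psi: "dirichlet_character q psi" "psi a \<noteq> 1"
      using dirichlet_character_separates a q by metis
    \<comment> \<open>The product of \<open>psi\<close> and its conjugate is the principal
      character, a unit for multiplication of characters; hence multiplication by \<open>psi\<close>
      is invertible.\<close>
    have inv: "(\<lambda>n. chi n * psi n * cnj (psi n)) = chi" if "dirichlet_character q chi" for chi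
    proof
      fix n
      have "psi n * cnj (psi n) = (if coprime n q then 1 else 0)"
        using norm_dirichlet_character[OF psi(1) q, of n]
        by (simp add: complex_norm_square[symmetric])
      thus "chi n * psi n * cnj (psi n) = chi n"
        using dirichlet_character_eq_0_iff[OF that, of n] by (auto simp: mult.assoc)
    qed
    have psi': "dirichlet_character q (\<lambda>n. cnj (psi n))"
      by (rule dirichlet_character_cnj[OF psi(1)])
    have "bij_betw (\<lambda>chi n. chi n * psi n) ?X ?X"
    proof (rule bij_betwI[where g = "\<lambda>chi n. chi n * cnj (psi n)"])
      show "(\<lambda>n. chi n * psi n * cnj (psi n)) = chi" if "chi \<in> ?X" for chi
        using that inv by simp
      show "(\<lambda>n. chi n * cnj (psi n) * psi n) = chi" if "chi \<in> ?X" for chi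
        using inv[of chi] that by (simp add: mult.assoc mult.commute[of "cnj _"])
    qed (use dirichlet_character_times psi(1) psi' in auto)
    hence "(\<Sum>chi\<in>?X. chi a) = (\<Sum>chi\<in>?X. chi a * psi a)"
      using sum.reindex_bij_betw[of "\<lambda>chi n. chi n * psi n" ?X ?X "\<lambda>chi. chi a"] by simp
    also have "\<dots> = (\<Sum>chi\<in>?X. chi a) * psi a"
      by (simp add: sum_distrib_right)
    finally have "(\<Sum>chi\<in>?X. chi a) * (1 - psi a) = 0" by (simp add: ring_distribs)
    with psi(2) show ?thesis by simp
  next
    case False
    thus ?thesis by (intro sum.neutral) (auto simp: dirichlet_character_eq_0_iff)
  qed
  have one: "(\<Sum>chi\<in>?X. chi b) = of_nat (card ?X)" if "[b = 1] (mod q)" for b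
  proof -
    have "chi b = 1" if "chi \<in> ?X" for chi
      using that dirichlet_character_cong[of q chi b 1] \<open>[b = 1] (mod q)\<close>
        dirichlet_character_1[of q chi] by simp
    hence "(\<Sum>chi\<in>?X. chi b) = (\<Sum>chi\<in>?X. 1)" by (intro sum.cong) simp_all
    thus ?thesis by simp
  qed
  \<comment> \<open>Summing over characters first leaves only the class of 1; summing over residues
    first leaves only the principal character. Writing \<open>1 mod q\<close> also covers
    \<open>q = 1\<close>, where that class is represented by 0.\<close>
  have "(\<Sum>n<q. \<Sum>chi\<in>?X. chi n) = (\<Sum>n<q. if n = 1 mod q then of_nat (card ?X) else 0)"
    using nontriv one by (intro sum.cong refl) (auto simp: cong_def)
  also have "\<dots> = of_nat (card ?X)" using q by simp
  also have "(\<Sum>n<q. \<Sum>chi\<in>?X. chi n) =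
      (\<Sum>chi\<in>?X. if chi = principal_character q then of_nat (totient q) else 0)"
    by (subst sum.swap) (auto intro!: sum.cong simp: sum_dirichlet_character_residues q)
  also have "\<dots> = of_nat (totient q)"
    using finite_dirichlet_characters[OF q] dirichlet_character_principal by simp
  finally show ?thesis using nontriv one by simp
qed

text \<open>For a unit \<open>b\<close> the number \<open>cnj (chi b)\<close> is the value of
  \<open>chi\<close> at an inverse of \<open>b\<close> modulo \<open>q\<close>, here the Euler power
  \<open>b'\<close>.\<close>

lemma dirichlet_characters_orthogonal:
  assumes q: "q > 0" and "coprime b q"
  shows "(\<Sum>chi | dirichlet_character q chi. chi a * cnj (chi b)) =
           (if [a = b] (mod q) then of_nat (totient q) else 0)"
proof -
  define b' where "b' = b ^ (totient q - 1)"
  have bb: "[b * b' = 1] (mod q)"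
    using euler_theorem[OF assms(2)] q by (simp add: b'_def power_eq_if)
  have "cnj (chi b) = chi b'" if chi: "dirichlet_character q chi" for chi
  proof -
    have "chi b * chi b' = 1"
      using dirichlet_character_cong[OF chi bb] dirichlet_character_1[OF chi]
      by (simp add: dirichlet_character_mult[OF chi])
    moreover have "chi b * cnj (chi b) = 1"
      using norm_dirichlet_character[OF chi q, of b] assms(2)
      by (simp add: complex_norm_square[symmetric])
    ultimately show ?thesis by (metis mult_cancel_left zero_neq_one mult_zero_left)
  qed
  hence "(\<Sum>chi | dirichlet_character q chi. chi a * cnj (chi b)) =
           (\<Sum>chi | dirichlet_character q chi. chi (a * b'))"
    by (intro sum.cong) (auto simp: dirichlet_character_mult)
  moreover have "[a * b' = 1] (mod q) \<longleftrightarrow> [a = b] (mod q)"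
  proof
    assume "[a * b' = 1] (mod q)"
    hence "[a * b' = b * b'] (mod q)" using bb by (metis cong_sym cong_trans)
    moreover have "coprime b' q" using assms(2) by (simp add: b'_def)
    ultimately show "[a = b] (mod q)" by (metis cong_mult_rcancel_nat)
  next
    assume "[a = b] (mod q)"
    thus "[a * b' = 1] (mod q)" using bb by (meson cong_scalar_right cong_trans)
  qed
  ultimately show ?thesis using sum_over_dirichlet_characters[OF q, of "a * b'"] by simp
qed

section \<open>The value of \<open>L\<close> at 1\<close>

primrec powr_diff :: "nat \<Rightarrow> complex \<Rightarrow> complex \<Rightarrow> complex" where
  "powr_diff 0 s x = x powr (- s)"
| "powr_diff (Suc k) s x = powr_diff k s (x + 1) - powr_diff k s x"

text \<open>Differentiation in \<open>x\<close> commutes with taking differences, so it only raises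
  \<open>s\<close> by one and brings out the factor \<open>- s\<close>.\<close>

lemma has_field_derivative_powr_diff:
  assumes "Re x > 0"
  shows "(powr_diff k s has_field_derivative - s * powr_diff k (s + 1) x) (at x)"
  using assms
proof (induction k arbitrary: x)
  case 0
  hence "x \<notin> \<real>\<^sub>\<le>\<^sub>0" by (auto simp: complex_nonpos_Reals_iff)
  moreover have "- s - 1 = - (s + 1)" by simp
  moreover have "powr_diff 0 s = (\<lambda>x. x powr (- s))" by auto
  moreover note has_field_derivative_powr[of x "- s"]
  ultimately show ?case by (metis powr_diff.simps(1))
next
  case (Suc k)
  have "((\<lambda>x. powr_diff k s (x + 1)) has_field_derivative - s * powr_diff k (s + 1) (x + 1)) (at x)"
    using Suc.IH[of "x + 1"] Suc.prems by (simp add: DERIV_shift)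
  from DERIV_diff[OF this Suc.IH[OF Suc.prems]] show ?case
    by (simp add: algebra_simps)
qed

text \<open>A difference over a unit step is at most the supremum of the derivative, which is
  \<open>s\<close> times a difference of one order less at \<open>s + 1\<close>. Each order thus
  costs a factor \<open>norm (s + of_nat i)\<close> and gains one power of \<open>x\<close>.\<close>

lemma norm_powr_diff_le:
  assumes "x > 0" "Re s + real k \<ge> 0"
  shows "norm (powr_diff k s (of_real x)) \<le> (\<Prod>i<k. norm (s + of_nat i)) * x powr (- (Re s + real k))"
  using assms
proof (induction k arbitrary: s x)
  case 0
  thus ?case by (simp add: norm_powr_real_powr)
next
  case (Suc k)
  let ?B = "norm s * ((\<Prod>i<k. norm (s + 1 + of_nat i)) * x powr (- (Re s + 1 + real k)))"
  have der: "norm (- s * powr_diff k (s + 1) z) \<le> ?B"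
    if z: "z \<in> closed_segment (of_real x) (of_real (x + 1))" for z
  proof -
    from z obtain y where y: "z = of_real y" "y \<in> closed_segment x (x + 1)"
      unfolding closed_segment_of_real by blast
    hence yx: "x \<le> y" by (simp add: closed_segment_eq_real_ivl)
    have "norm (powr_diff k (s + 1) z) \<le>
            (\<Prod>i<k. norm (s + 1 + of_nat i)) * y powr (- (Re (s + 1) + real k))"
      unfolding y(1) using yx Suc.prems by (intro Suc.IH) auto
    \<comment> \<open>The exponent is nonpositive, so the left endpoint of the segment
      dominates.\<close>
    also have "\<dots> \<le> (\<Prod>i<k. norm (s + 1 + of_nat i)) * x powr (- (Re (s + 1) + real k))"
      using yx Suc.prems by (intro mult_left_mono powr_mono2' prod_nonneg) auto
    finally show ?thesis by (simp add: norm_mult mult_left_mono)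
  qed
  have "norm (powr_diff k s (of_real (x + 1)) - powr_diff k s (of_real x)) \<le>
          ?B * norm (of_real (x + 1) - of_real x :: complex)"
  proof (rule field_differentiable_bound[OF convex_closed_segment _ der])
    fix z :: complex assume z: "z \<in> closed_segment (of_real x) (of_real (x + 1))"
    then obtain y where y: "z = of_real y" "y \<in> closed_segment x (x + 1)"
      unfolding closed_segment_of_real by blast
    hence "Re z > 0" using Suc.prems by (simp add: closed_segment_eq_real_ivl)
    thus "(powr_diff k s has_field_derivative - s * powr_diff k (s + 1) z)
            (at z within closed_segment (of_real x) (of_real (x + 1)))"
      by (rule has_field_derivative_at_within[OF has_field_derivative_powr_diff])
  qed auto
  also have "norm (of_real (x + 1) - of_real x :: complex) = 1"
    by simp
  also have "?B * 1 = (\<Prod>i<Suc k. norm (s + of_nat i)) * x powr (- (Re s + real (Suc k)))"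
    by (subst prod.lessThan_Suc_shift) (simp add: algebra_simps)
  finally show ?case by simp
qed

lemma holomorphic_on_powr_diff:
  assumes "Re x > 0"
  shows "(\<lambda>s. powr_diff k s x) holomorphic_on A"
  using assms
proof (induction k arbitrary: x)
  case 0
  hence "x \<noteq> 0" by auto
  thus ?case by (auto intro!: holomorphic_intros)
next
  case (Suc k)
  thus ?case by (auto intro!: holomorphic_intros)
qed

text \<open>The coefficient \<open>c n\<close> belongs to the integer \<open>n + 1\<close>; for
  \<open>k = 0\<close> this is an ordinary Dirichlet series.\<close>

definition powr_diff_series :: "nat \<Rightarrow> (nat \<Rightarrow> complex) \<Rightarrow> complex \<Rightarrow> complex" where
  "powr_diff_series k c s = (\<Sum>n. c n * powr_diff k s (of_nat (Suc n)))"

text \<open>The margin \<open>2 * r\<close> leaves \<open>Re z + real k \<ge> 1 + r\<close> on the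
  whole disc, so the terms are dominated by a multiple of a convergent series with exponent
  \<open>1 + r\<close>.\<close>

lemma uniform_limit_powr_diff_series:
  assumes c: "\<And>n. norm (c n) \<le> B" and r: "r > 0" and s: "Re s > 1 - real k + 2 * r"
  shows "uniform_limit (cball s r) (\<lambda>N s. \<Sum>n<N. c n * powr_diff k s (of_nat (Suc n)))
           (powr_diff_series k c) sequentially"
  unfolding powr_diff_series_def
proof (rule Weierstrass_m_test)
  let ?P = "\<Prod>i<k. norm s + r + real i"
  have B: "B \<ge> 0" using c[of 0] norm_ge_zero order_trans by blast
  have "summable (\<lambda>n. real n powr (- (1 + r)))"
    using r by (subst summable_real_powr_iff) auto
  hence "summable (\<lambda>n. real (Suc n) powr (- (1 + r)))"
    by (subst summable_Suc_iff)
  thus "summable (\<lambda>n. B * (?P * real (Suc n) powr (- (1 + r))))"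
    by (intro summable_mult)
  fix n z assume z: "z \<in> cball s r"
  have nz: "norm z \<le> norm s + r"
    using z norm_triangle_ineq[of s "z - s"] by (simp add: dist_norm norm_minus_commute)
  have "\<bar>Re (s - z)\<bar> \<le> norm (s - z)" by (rule abs_Re_le_cmod)
  hence "\<bar>Re s - Re z\<bar> \<le> r" using z by (simp add: dist_norm)
  hence rz: "1 + r \<le> Re z + real k" using s r by linarith
  have "norm (powr_diff k z (of_real (real (Suc n)))) \<le>
          (\<Prod>i<k. norm (z + of_nat i)) * real (Suc n) powr (- (Re z + real k))"
    using rz r by (intro norm_powr_diff_le) auto
  also have "\<dots> \<le> ?P * real (Suc n) powr (- (1 + r))"
  proof (intro mult_mono prod_mono powr_mono conjI)
    fix i
    show "norm (z + of_nat i) \<le> norm s + r + real i"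
      using norm_triangle_ineq[of z "of_nat i"] nz by simp
  qed (use rz r in \<open>auto intro!: prod_nonneg\<close>)
  finally show "norm (c n * powr_diff k z (of_nat (Suc n))) \<le> B * (?P * real (Suc n) powr (- (1 + r)))"
    using B c[of n] by (simp add: norm_mult mult_mono)
qed

lemma holomorphic_on_powr_diff_series:
  assumes c: "\<And>n. norm (c n) \<le> B"
  shows "powr_diff_series k c holomorphic_on {s. Re s > 1 - real k}"
proof (rule holomorphic_uniform_sequence)
  show "open {s. Re s > 1 - real k}" by (rule open_halfspace_Re_gt)
  show "(\<lambda>s. \<Sum>n<N. c n * powr_diff k s (of_nat (Suc n))) holomorphic_on {s. Re s > 1 - real k}" for N
    by (intro holomorphic_intros holomorphic_on_powr_diff) auto
  fix s assume s: "s \<in> {s. Re s > 1 - real k}"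
  \<comment> \<open>One third of the distance to the boundary line leaves room for the margin
    \<open>2 * r\<close> with strict inequality.\<close>
  define r where "r = (Re s - 1 + real k) / 3"
  have r3: "3 * r = Re s - 1 + real k" by (simp add: r_def)
  have r: "r > 0" using s by (simp add: r_def)
  have "cball s r \<subseteq> {s. Re s > 1 - real k}"
  proof
    fix z assume z: "z \<in> cball s r"
    have "\<bar>Re (s - z)\<bar> \<le> norm (s - z)" by (rule abs_Re_le_cmod)
    hence "\<bar>Re s - Re z\<bar> \<le> r" using z by (simp add: dist_norm)
    hence "Re z > 1 - real k" using r r3 by linarith
    thus "z \<in> {s. Re s > 1 - real k}" by simp
  qed
  moreover have "uniform_limit (cball s r) (\<lambda>N s. \<Sum>n<N. c n * powr_diff k s (of_nat (Suc n)))
           (powr_diff_series k c) sequentially"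
    by (rule uniform_limit_powr_diff_series[OF c r]) (use r r3 in linarith)
  ultimately show "\<exists>d>0. cball s d \<subseteq> {s. Re s > 1 - real k} \<and>
      uniform_limit (cball s d) (\<lambda>N s. \<Sum>n<N. c n * powr_diff k s (of_nat (Suc n)))
           (powr_diff_series k c) sequentially"
    using r by blast
qed

lemma powr_diff_series_sums:
  assumes c: "\<And>n. norm (c n) \<le> B" and s: "Re s > 1 - real k"
  shows "(\<lambda>n. c n * powr_diff k s (of_nat (Suc n))) sums powr_diff_series k c s"
proof -
  define r where "r = (Re s - 1 + real k) / 3"
  have r3: "3 * r = Re s - 1 + real k" by (simp add: r_def)
  have r: "r > 0" using s by (simp add: r_def)
  have "uniform_limit (cball s r) (\<lambda>N s. \<Sum>n<N. c n * powr_diff k s (of_nat (Suc n)))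
           (powr_diff_series k c) sequentially"
    by (rule uniform_limit_powr_diff_series[OF c r]) (use r r3 in linarith)
  from tendsto_uniform_limitI[OF this, of s] r show ?thesis
    by (simp add: sums_def)
qed

section \<open>Repeated partial summation and the entire continuation\<close>

lemma sum_by_parts:
  fixes u h :: "nat \<Rightarrow> 'a :: comm_ring"
  assumes "M \<le> N"
  shows "(\<Sum>n=M..<N. (u (Suc n) - u n) * h n) =
           u N * h N - u M * h M - (\<Sum>n=M..<N. u (Suc n) * (h (Suc n) - h n))"
  using assms by (induction N rule: dec_induct) (simp_all add: algebra_simps)

definition mean_zero :: "nat \<Rightarrow> (nat \<Rightarrow> complex) \<Rightarrow> bool" where
  "mean_zero q c \<longleftrightarrow> (\<forall>n. c (n + q) = c n) \<and> (\<Sum>n<q. c n) = 0"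

lemma periodic_mod:
  fixes c :: "nat \<Rightarrow> 'a"
  assumes "\<And>n. c (n + q) = c n"
  shows "c (n mod q) = c n"
proof -
  have "c (m + k * q) = c m" for m k
  proof (induction k)
    case (Suc k)
    thus ?case using assms[of "m + k * q"] by (simp add: ac_simps)
  qed simp
  thus ?thesis by (metis mod_div_mult_eq)
qed

lemma periodic_bounded:
  fixes c :: "nat \<Rightarrow> complex"
  assumes "\<And>n. c (n + q) = c n" "q > 0"
  obtains B where "\<And>n. norm (c n) \<le> B"
proof
  fix n
  have "norm (c n) = norm (c (n mod q))" using periodic_mod[of c q, OF assms(1)] by simp
  also have "\<dots> \<le> (\<Sum>m<q. norm (c m))"
    using assms(2) by (intro member_le_sum) auto
  finally show "norm (c n) \<le> (\<Sum>m<q. norm (c m))" .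
qed

lemma mean_zero_partial_sum_periodic:
  assumes "mean_zero q c"
  shows "(\<Sum>m<n + q. c m) = (\<Sum>m<n. c m)"
  using assms by (induction n) (auto simp: mean_zero_def)

text \<open>The partial sums are periodic because a full period sums to zero. Subtracting their mean
  \<open>a\<close> gives mean zero again, so the step can be repeated.\<close>

lemma mean_zero_antidifference:
  assumes "mean_zero q c" "q > 0"
  obtains u where "\<And>n. c n = u (Suc n) - u n" "mean_zero q (\<lambda>n. u (Suc n))" "\<And>n. u (n + q) = u n"
proof
  define a where "a = (\<Sum>n<q. \<Sum>m<n. c m) / of_nat q"
  define u where "u n = (\<Sum>m<n. c m) - a" for n
  show "c n = u (Suc n) - u n" for n by (simp add: u_def)
  show per: "u (n + q) = u n" for n
    by (simp add: u_def mean_zero_partial_sum_periodic[OF assms(1)])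
  have "(\<Sum>n<q. u (Suc n)) = (\<Sum>n<Suc q. u n) - u 0"
    by (subst sum.lessThan_Suc_shift) simp
  also have "\<dots> = (\<Sum>n<q. u n)" using per[of 0] by simp
  also have "\<dots> = 0" using assms(2) by (simp add: u_def a_def sum_subtractf)
  finally show "mean_zero q (\<lambda>n. u (Suc n))"
    unfolding mean_zero_def using per[of "Suc n" for n] by simp
qed

text \<open>Partial summation trades \<open>c\<close> for its bounded antidifference and raises the
  order of the difference, which moves the region of convergence one unit to the left.\<close>

lemma powr_diff_series_by_parts:
  assumes u: "\<And>n. c n = u (Suc n) - u n" and B: "\<And>n. norm (u n) \<le> B" and s: "Re s > 1 - real k"
  shows "powr_diff_series k c s = - u 0 * powr_diff k s 1 - powr_diff_series (Suc k) (\<lambda>n. u (Suc n)) s"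
proof -
  have "norm (c n) \<le> B + B" for n
    unfolding u using norm_triangle_ineq4[of "u (Suc n)" "u n"] B[of "Suc n"] B[of n] by linarith
  note lim = powr_diff_series_sums[OF this s]
  have lim': "(\<lambda>n. u (Suc n) * powr_diff (Suc k) s (of_nat (Suc n))) sums
                powr_diff_series (Suc k) (\<lambda>n. u (Suc n)) s"
    by (rule powr_diff_series_sums[OF B]) (use s in auto)
  \<comment> \<open>The upper boundary term decays like a power of \<open>N\<close> with exponent
    \<open>- (Re s + real k)\<close>, which is below -1.\<close>
  have "(\<lambda>N. norm (u N * powr_diff k s (of_nat (Suc N)))) \<longlonglongrightarrow> 0"
  proof (rule tendsto_sandwich[OF _ _ tendsto_const])
    have "(\<lambda>N. real (Suc N) powr (- (Re s + real k))) \<longlonglongrightarrow> 0"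
      by (intro tendsto_neg_powr filterlim_compose[OF filterlim_real_sequentially] filterlim_Suc)
         (use s in auto)
    thus "(\<lambda>N. B * ((\<Prod>i<k. norm (s + of_nat i)) * real (Suc N) powr (- (Re s + real k)))) \<longlonglongrightarrow> 0"
      by (intro tendsto_mult_right_zero)
    have "norm (powr_diff k s (of_real (real (Suc N)))) \<le>
          (\<Prod>i<k. norm (s + of_nat i)) * real (Suc N) powr (- (Re s + real k))" for N
      using s by (intro norm_powr_diff_le) auto
    moreover have "B \<ge> 0" using B[of 0] norm_ge_zero order_trans by blast
    ultimately have "norm (u N * powr_diff k s (of_nat (Suc N))) \<le>
        B * ((\<Prod>i<k. norm (s + of_nat i)) * real (Suc N) powr (- (Re s + real k)))" for N
      unfolding norm_mult using B[of N] by (intro mult_mono) auto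
    thus "\<forall>\<^sub>F N in sequentially. norm (u N * powr_diff k s (of_nat (Suc N))) \<le>
        B * ((\<Prod>i<k. norm (s + of_nat i)) * real (Suc N) powr (- (Re s + real k)))"
      by simp
  qed auto
  hence end0: "(\<lambda>N. u N * powr_diff k s (of_nat (Suc N))) \<longlonglongrightarrow> 0"
    by (rule tendsto_norm_zero_cancel)
  have "(\<Sum>n<N. c n * powr_diff k s (of_nat (Suc n))) =
          u N * powr_diff k s (of_nat (Suc N)) - u 0 * powr_diff k s 1
          - (\<Sum>n<N. u (Suc n) * powr_diff (Suc k) s (of_nat (Suc n)))" for N
    using sum_by_parts[of 0 N u "\<lambda>n. powr_diff k s (of_nat (Suc n))"]
    by (simp add: u atLeast0LessThan add_ac)
  moreover have "(\<lambda>N. u N * powr_diff k s (of_nat (Suc N)) - u 0 * powr_diff k s 1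
          - (\<Sum>n<N. u (Suc n) * powr_diff (Suc k) s (of_nat (Suc n)))) \<longlonglongrightarrow>
          0 - u 0 * powr_diff k s 1 - powr_diff_series (Suc k) (\<lambda>n. u (Suc n)) s"
    using lim' unfolding sums_def by (intro tendsto_intros end0)
  ultimately have "(\<lambda>N. \<Sum>n<N. c n * powr_diff k s (of_nat (Suc n))) \<longlonglongrightarrow>
          0 - u 0 * powr_diff k s 1 - powr_diff_series (Suc k) (\<lambda>n. u (Suc n)) s"
    by simp
  from LIMSEQ_unique[OF this lim[unfolded sums_def]] show ?thesis by simp
qed

text \<open>Each of the \<open>j\<close> partial summations extends the half-plane by one unit. Both
  \<open>k\<close> and \<open>c\<close> vary in the induction, since a step replaces
  \<open>k\<close> by \<open>Suc k\<close> and \<open>c\<close> by an antidifference.\<close>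

lemma powr_diff_series_continuation:
  assumes "mean_zero q c" "q > 0"
  shows "\<exists>f. f holomorphic_on {s. Re s > 1 - real k - real j} \<and>
             (\<forall>s. Re s > 1 - real k \<longrightarrow> f s = powr_diff_series k c s)"
  using assms(1)
proof (induction j arbitrary: k c)
  case 0
  have per: "c (n + q) = c n" for n using 0 by (simp add: mean_zero_def)
  obtain B where "\<And>n. norm (c n) \<le> B" using periodic_bounded[of c q, OF per assms(2)] by blast
  from holomorphic_on_powr_diff_series[of c, OF this, of k]
  show ?case by (intro exI[of _ "powr_diff_series k c"]) auto
next
  case (Suc j)
  obtain u where u: "\<And>n. c n = u (Suc n) - u n" "mean_zero q (\<lambda>n. u (Suc n))" "\<And>n. u (n + q) = u n"
    using mean_zero_antidifference[OF Suc.prems assms(2)] by metis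
  obtain B where B: "\<And>n. norm (u n) \<le> B" using periodic_bounded[of u q, OF u(3) assms(2)] by blast
  obtain f where f: "f holomorphic_on {s. Re s > 1 - real (Suc k) - real j}"
    "\<And>s. Re s > 1 - real (Suc k) \<Longrightarrow> f s = powr_diff_series (Suc k) (\<lambda>n. u (Suc n)) s"
    using Suc.IH[OF u(2), of "Suc k"] by blast
  have set_eq: "{s. Re s > 1 - real (Suc k) - real j} = {s. Re s > 1 - real k - real (Suc j)}"
    by auto
  show ?case
  proof (intro exI[of _ "\<lambda>s. - u 0 * powr_diff k s 1 - f s"] conjI allI impI)
    show "(\<lambda>s. - u 0 * powr_diff k s 1 - f s) holomorphic_on {s. Re s > 1 - real k - real (Suc j)}"
      using f(1) unfolding set_eq by (intro holomorphic_intros holomorphic_on_powr_diff) auto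
    fix s assume "Re s > 1 - real k"
    thus "- u 0 * powr_diff k s 1 - f s = powr_diff_series k c s"
      using f(2)[of s] powr_diff_series_by_parts[of c u, OF u(1) B] by simp
  qed
qed

text \<open>By the identity theorem the continuations agree wherever two of them are defined, so at
  each point any sufficiently far-reaching one may be used.\<close>

lemma holomorphic_halfplanes_glue:
  assumes "\<And>j::nat. \<exists>f. f holomorphic_on {s. Re s > 1 - real j} \<and> (\<forall>s. Re s > 1 \<longrightarrow> f s = g s)"
  shows "\<exists>f. f holomorphic_on UNIV \<and> (\<forall>s. Re s > 1 \<longrightarrow> f s = g s)"
proof -
  from assms obtain F where F: "\<And>j::nat. F j holomorphic_on {s. Re s > 1 - real j}"
    "\<And>j s. Re s > 1 \<Longrightarrow> F j s = g s"
    by metis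
  have agree: "F i s = F j s" if "i \<le> j" "Re s > 1 - real i" for i j s
  proof -
    have "F i s - F j s = 0"
    proof (rule analytic_continuation[where U = "{s. Re s > 1}" and S = "{s. Re s > 1 - real i}"
          and \<xi> = 2 and f = "\<lambda>s. F i s - F j s"])
      show "(\<lambda>s. F i s - F j s) holomorphic_on {s. Re s > 1 - real i}"
        using that by (intro holomorphic_intros F(1) holomorphic_on_subset[OF F(1)]) auto
      show "connected {s. Re s > 1 - real i}"
        by (intro convex_connected convex_halfspace_Re_gt)
      show "(2::complex) islimpt {s. 1 < Re s}"
        by (rule interior_limit_point) (simp add: interior_open open_halfspace_Re_gt)
    qed (use that F(2) in \<open>auto simp: open_halfspace_Re_gt\<close>)
    thus ?thesis by simp
  qed
  \<comment> \<open>This index puts \<open>s\<close> at distance at least one from the boundary of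
    the half-plane.\<close>
  define f where "f s = F (nat \<lceil>2 - Re s\<rceil>) s" for s
  have f_eq: "f s = F j s" if "Re s > 2 - real j" for s j
  proof -
    have "nat \<lceil>2 - Re s\<rceil> \<le> j" using that by (simp add: nat_le_iff ceiling_le_iff)
    moreover have "Re s > 1 - real (nat \<lceil>2 - Re s\<rceil>)" by linarith
    ultimately show ?thesis unfolding f_def by (rule agree)
  qed
  have "f field_differentiable (at s)" for s
  proof -
    \<comment> \<open>One index further, so that \<open>f\<close> equals the single function
      \<open>F j\<close> on an open half-plane containing \<open>s\<close>.\<close>
    define j where "j = nat \<lceil>3 - Re s\<rceil>"
    have j: "Re s > 2 - real j" unfolding j_def by linarith
    have "F j holomorphic_on {s. Re s > 2 - real j}"
      by (rule holomorphic_on_subset[OF F(1)]) auto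
    hence "f holomorphic_on {s. Re s > 2 - real j}"
      using f_eq by (subst holomorphic_cong[OF refl, of _ _ "F j"]) auto
    thus ?thesis using j
      by (intro holomorphic_on_imp_differentiable_at[of f "{s. Re s > 2 - real j}"])
         (auto simp: open_halfspace_Re_gt)
  qed
  hence "f holomorphic_on UNIV" by (simp add: holomorphic_on_def field_differentiable_at_within)
  moreover have "f s = g s" if "Re s > 1" for s using that F(2) by (simp add: f_def)
  ultimately show ?thesis by blast
qed

section \<open>Non-principal \<open>L\<close>-functions and their truncation at 1\<close>

lemma mean_zero_dirichlet_character:
  assumes chi: "dirichlet_character q chi" "chi \<noteq> principal_character q" and q: "q > 0"
  shows "mean_zero q (\<lambda>n. chi (Suc n))"
proof -
  have per: "chi (n + q) = chi n" for n
    using chi(1) by (simp add: dirichlet_character_def)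
  have "(\<Sum>n<q. chi (Suc n)) = (\<Sum>n<Suc q. chi n) - chi 0"
    by (subst sum.lessThan_Suc_shift) simp
  also have "\<dots> = (\<Sum>n<q. chi n)" using per[of 0] by simp
  also have "\<dots> = 0" using sum_dirichlet_character_residues[OF chi(1) q] chi(2) by simp
  finally show ?thesis using per[of "Suc n" for n] by (simp add: mean_zero_def)
qed

text \<open>\<open>dirichlet_L\<close> is a choice among the functions with these two properties;
  the continuation just constructed shows that one exists.\<close>

lemma dirichlet_L_continuation:
  assumes chi: "dirichlet_character q chi" "chi \<noteq> principal_character q" and q: "q > 0"
  shows "dirichlet_L q chi holomorphic_on UNIV"
    and "\<And>s. Re s > 1 \<Longrightarrow> dirichlet_L q chi s = powr_diff_series 0 (\<lambda>n. chi (Suc n)) s"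
proof -
  have "\<exists>f. f holomorphic_on {s. Re s > 1 - real j} \<and>
            (\<forall>s. Re s > 1 \<longrightarrow> f s = powr_diff_series 0 (\<lambda>n. chi (Suc n)) s)" for j
    using powr_diff_series_continuation[OF mean_zero_dirichlet_character[OF chi q] q, of 0 j] by simp
  from holomorphic_halfplanes_glue[OF this]
  have "\<exists>f. f holomorphic_on UNIV \<and>
            (\<forall>s. Re s > 1 \<longrightarrow> f s = (\<Sum>n. chi (Suc n) / of_nat (Suc n) powr s))"
    by (simp add: powr_diff_series_def powr_minus divide_inverse)
  from someI_ex[OF this] chi(2)
  have "dirichlet_L q chi holomorphic_on UNIV \<and>
          (\<forall>s. Re s > 1 \<longrightarrow> dirichlet_L q chi s = (\<Sum>n. chi (Suc n) / of_nat (Suc n) powr s))"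
    unfolding dirichlet_L_def by simp
  thus "dirichlet_L q chi holomorphic_on UNIV"
    "\<And>s. Re s > 1 \<Longrightarrow> dirichlet_L q chi s = powr_diff_series 0 (\<lambda>n. chi (Suc n)) s"
    by (simp_all add: powr_diff_series_def powr_minus divide_inverse)
qed

text \<open>Full periods cancel, and fewer than \<open>q\<close> terms remain.\<close>

lemma norm_mean_zero_partial_sum_le:
  assumes "mean_zero q c" "\<And>n. norm (c n) \<le> 1" "q > 0"
  shows "norm (\<Sum>m<n. c m) \<le> real q"
proof -
  have "(\<Sum>m<n. c m) = (\<Sum>m<n mod q. c m)"
    using periodic_mod[of "\<lambda>n. \<Sum>m<n. c m" q n] mean_zero_partial_sum_periodic[OF assms(1)] by simp
  also have "norm \<dots> \<le> real (card {..<n mod q}) * 1"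
    by (intro sum_norm_bound assms(2))
  also have "\<dots> \<le> real q"
    using assms(3) by (simp add: less_imp_le)
  finally show ?thesis .
qed

text \<open>After partial summation the variation of \<open>h\<close> telescopes to
  \<open>h M - h N\<close>; together with the two boundary terms this gives
  \<open>2 * B * h M\<close>.\<close>

lemma norm_sum_decreasing_le:
  fixes u :: "nat \<Rightarrow> complex" and h :: "nat \<Rightarrow> real"
  assumes "M \<le> N" "\<And>n. norm (u n) \<le> B" "\<And>n. 0 \<le> h n" "\<And>n. h (Suc n) \<le> h n"
  shows "norm (\<Sum>n=M..<N. (u (Suc n) - u n) * of_real (h n)) \<le> 2 * B * h M"
proof -
  have "(\<Sum>n=M..<N. (u (Suc n) - u n) * of_real (h n)) =
          u N * of_real (h N) - u M * of_real (h M)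
          - (\<Sum>n=M..<N. u (Suc n) * (of_real (h (Suc n)) - of_real (h n)))"
    by (rule sum_by_parts[OF assms(1)])
  also have "norm \<dots> \<le> norm (u N * of_real (h N)) + norm (u M * of_real (h M))
          + norm (\<Sum>n=M..<N. u (Suc n) * (of_real (h (Suc n)) - of_real (h n)))"
    by (meson add_mono norm_triangle_ineq4 order_refl order_trans)
  also have "\<dots> \<le> B * h N + B * h M + (\<Sum>n=M..<N. B * (h n - h (Suc n)))"
  proof (intro add_mono sum_norm_le)
    fix n
    have "norm (u (Suc n) * (of_real (h (Suc n)) - of_real (h n))) =
            norm (u (Suc n)) * (h n - h (Suc n))"
      using assms(4)[of n] by (simp add: norm_mult flip: of_real_diff)
    also have "\<dots> \<le> B * (h n - h (Suc n))"
      using assms(2,4) by (intro mult_right_mono) auto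
    finally show "norm (u (Suc n) * (of_real (h (Suc n)) - of_real (h n))) \<le> B * (h n - h (Suc n))" .
  qed (use assms(2,3) in \<open>auto simp: norm_mult intro!: mult_right_mono\<close>)
  also have "(\<Sum>n=M..<N. B * (h n - h (Suc n))) = B * (h M - h N)"
    using sum_Suc_diff'[OF assms(1), of h]
    by (simp add: sum_distrib_left[symmetric] sum_subtractf)
  finally show ?thesis by (simp add: algebra_simps)
qed

text \<open>The series represents the function for \<open>Re s > 1\<close>, so the tail is bounded
  uniformly for real \<open>s > 1\<close>, and the bound passes to \<open>s = 1\<close> by
  continuity of both sides.\<close>

lemma dirichlet_L_1_approx:
  assumes chi: "dirichlet_character q chi" "chi \<noteq> principal_character q" and q: "q > 0"
  shows "norm (dirichlet_L q chi 1 - (\<Sum>n=1..N. chi n / of_nat n)) \<le> 2 * real q / real (N + 1)"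
proof -
  define c where "c n = chi (Suc n)" for n
  note L = dirichlet_L_continuation[OF chi q, folded c_def]
  define P where "P s = (\<Sum>n<N. c n * of_nat (Suc n) powr (- s))" for s :: complex
  have c1: "norm (c n) \<le> 1" for n
    by (simp add: c_def norm_dirichlet_character[OF chi(1) q])
  have mz: "mean_zero q c"
    unfolding c_def by (rule mean_zero_dirichlet_character[OF chi q])
  have bound: "norm (dirichlet_L q chi (of_real s) - P (of_real s)) \<le> 2 * real q / real (N + 1)"
    if s: "s > 1" for s :: real
  proof (rule tendsto_upperbound)
    \<comment> \<open>Index \<open>n\<close> stands for the integer \<open>n + 1\<close>; the tail
      from index \<open>N\<close> starts at the integer \<open>N + 1\<close>, whence the
      denominator.\<close>
    define h where "h n = real (Suc n) powr (- s)" for n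
    define u where "u n = (\<Sum>m<n. c m)" for n
    have ch: "c n * powr_diff 0 (of_real s) (of_nat (Suc n)) = (u (Suc n) - u n) * of_real (h n)" for n
      using powr_of_real[of "real (Suc n)" "- s"] by (simp add: h_def u_def)
    have "(\<lambda>n. (u (Suc n) - u n) * of_real (h n)) sums dirichlet_L q chi (of_real s)"
      using powr_diff_series_sums[of c 1 0 "of_real s", OF c1] L(2)[of "of_real s"] s
      unfolding ch by simp
    hence "(\<lambda>M. \<Sum>n<M. (u (Suc n) - u n) * of_real (h n)) \<longlonglongrightarrow> dirichlet_L q chi (of_real s)"
      by (simp add: sums_def)
    thus "(\<lambda>M. norm ((\<Sum>n<M. (u (Suc n) - u n) * of_real (h n)) - P (of_real s)))
            \<longlonglongrightarrow> norm (dirichlet_L q chi (of_real s) - P (of_real s))"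
      by (intro tendsto_intros)
    show "\<forall>\<^sub>F M in sequentially.
        norm ((\<Sum>n<M. (u (Suc n) - u n) * of_real (h n)) - P (of_real s)) \<le> 2 * real q / real (N + 1)"
      using eventually_ge_at_top[of N]
    proof eventually_elim
      case (elim M)
      have "P (of_real s) = (\<Sum>n<N. (u (Suc n) - u n) * of_real (h n))"
        unfolding P_def ch[symmetric] by simp
      hence "(\<Sum>n<M. (u (Suc n) - u n) * of_real (h n)) - P (of_real s) =
               (\<Sum>n=N..<M. (u (Suc n) - u n) * of_real (h n))"
        using elim by (simp add: lessThan_atLeast0 sum_diff_nat_ivl)
      also have "norm \<dots> \<le> 2 * real q * h N"
      proof (rule norm_sum_decreasing_le[OF elim])
        show "norm (u n) \<le> real q" for n
          unfolding u_def by (rule norm_mean_zero_partial_sum_le[OF mz c1 q])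
        show "h (Suc n) \<le> h n" for n
          unfolding h_def using s by (intro powr_mono2') auto
      qed (simp add: h_def)
      \<comment> \<open>This removes the dependence on \<open>s\<close>.\<close>
      also have "h N \<le> real (Suc N) powr (- 1)"
        unfolding h_def using s by (intro powr_mono) auto
      hence "2 * real q * h N \<le> 2 * real q / real (N + 1)"
        using mult_left_mono[of "h N" "real (Suc N) powr (- 1)" "2 * real q"]
        by (simp add: powr_minus divide_inverse)
      finally show ?case .
    qed
  qed auto
  have "((\<lambda>s. norm (dirichlet_L q chi (of_real s) - P (of_real s)))
          \<longlongrightarrow> norm (dirichlet_L q chi (of_real 1) - P (of_real 1))) (at_right 1)"
  proof (intro tendsto_intros)
    have "isCont (dirichlet_L q chi) (of_real 1)"
      using holomorphic_on_imp_continuous_on[OF L(1)] by (simp add: continuous_on_eq_continuous_at)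
    thus "((\<lambda>s. dirichlet_L q chi (of_real s)) \<longlongrightarrow> dirichlet_L q chi (of_real 1)) (at_right 1)"
      by (rule isCont_tendsto_compose) (intro tendsto_intros)
    have "isCont P (of_real 1)"
      unfolding P_def by (intro continuous_intros) (auto simp del: of_nat_Suc)
    thus "((\<lambda>s. P (of_real s)) \<longlongrightarrow> P (of_real 1)) (at_right 1)"
      by (rule isCont_tendsto_compose) (intro tendsto_intros)
  qed
  hence "norm (dirichlet_L q chi (of_real 1) - P (of_real 1)) \<le> 2 * real q / real (N + 1)"
    by (rule tendsto_upperbound)
       (use bound in \<open>auto intro!: eventually_mono[OF eventually_at_right_less[of 1]]\<close>)
  also have "P (of_real 1) = (\<Sum>n=1..N. chi n / of_nat n)"
  proof -
    have "P (of_real 1) = (\<Sum>n<N. chi (Suc n) / of_nat (Suc n))"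
      by (simp add: P_def c_def powr_minus divide_inverse)
    also have "\<dots> = (\<Sum>n=1..N. chi n / of_nat n)"
      by (simp only: One_nat_def sum.atLeast1_atMost_eq)
    finally show ?thesis .
  qed
  finally show ?thesis by simp
qed

section \<open>The congruence \<open>a b \<equiv> c d (mod q)\<close>\<close>

lemma harm_le_1_plus_ln:
  assumes "n > 0"
  shows "harm n \<le> 1 + ln (real n)"
  using euler_mascheroni_sequence_decreasing[of 1 n] assms by (simp add: harm_Suc harm_def)

text \<open>Members of one class are told apart by their quotient by \<open>q\<close>. Quotient 0
  occurs at most once, for a number above \<open>sqrt q\<close>; a quotient \<open>k > 0\<close>
  forces \<open>a \<ge> q * k\<close>, which leads to a harmonic sum divided by
  \<open>q\<close>.\<close>

lemma sum_inverse_residue_class_le: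
  assumes q: "q > 0" and X: "X \<subseteq> {1..N}" "\<And>a. a \<in> X \<Longrightarrow> q < a ^ 2"
      and cl: "\<And>a a'. a \<in> X \<Longrightarrow> a' \<in> X \<Longrightarrow> [a = a'] (mod q)"
  shows "(\<Sum>a\<in>X. 1 / real a) \<le> 1 / sqrt (real q) + harm N / real q"
proof -
  define g where "g k = (if k = 0 then 1 / sqrt (real q) else 1 / (real q * real k))" for k :: nat
  have g0: "g k \<ge> 0" for k by (simp add: g_def)
  have inj: "inj_on (\<lambda>a. a div q) X"
  proof (rule inj_onI)
    fix a a' assume "a \<in> X" "a' \<in> X" "a div q = a' div q"
    with cl[of a a'] show "a = a'" by (metis cong_def div_mult_mod_eq)
  qed
  have "1 / real a \<le> g (a div q)" if a: "a \<in> X" for a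
  proof (cases "a div q = 0")
    case True
    have "sqrt (real q) \<le> sqrt (real a ^ 2)"
      using X(2)[OF a] by (intro real_sqrt_le_mono) (simp flip: of_nat_power)
    thus ?thesis using True q by (simp add: g_def frac_le)
  next
    case False
    have "q * (a div q) \<le> a" by simp
    hence "real q * real (a div q) \<le> real a" by (metis of_nat_le_iff of_nat_mult)
    moreover have "real q * real (a div q) > 0" using False q by simp
    ultimately show ?thesis using False by (simp add: g_def frac_le del: div_eq_0_iff)
  qed
  hence "(\<Sum>a\<in>X. 1 / real a) \<le> (\<Sum>a\<in>X. g (a div q))"
    by (intro sum_mono)
  also have "\<dots> = (\<Sum>k\<in>(\<lambda>a. a div q) ` X. g k)"
    using inj by (simp add: sum.reindex)
  also have "\<dots> \<le> (\<Sum>k\<in>{0..N}. g k)"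
  proof (intro sum_mono2 g0)
    show "(\<lambda>a. a div q) ` X \<subseteq> {0..N}"
      using X(1) by (auto intro!: order_trans[OF div_le_dividend])
  qed auto
  also have "\<dots> = g 0 + (\<Sum>k=1..N. g k)"
    by (simp add: sum.atLeast_Suc_atMost)
  also have "(\<Sum>k=1..N. g k) = (\<Sum>k=1..N. inverse (real k)) / real q"
    unfolding sum_divide_distrib by (intro sum.cong) (auto simp: g_def field_simps)
  finally show ?thesis by (simp add: g_def harm_def)
qed

text \<open>A pair indexes a term in the square of the truncated sum; only arguments where a
  character does not vanish are kept.\<close>

definition unit_pairs :: "nat \<Rightarrow> nat \<Rightarrow> (nat \<times> nat) set" where
  "unit_pairs q N = {n\<in>{1..N}. coprime n q} \<times> {n\<in>{1..N}. coprime n q}"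

abbreviation pair_prod :: "nat \<times> nat \<Rightarrow> nat" where
  "pair_prod p \<equiv> fst p * snd p"

lemma finite_unit_pairs [simp]: "finite (unit_pairs q N)"
  by (simp add: unit_pairs_def)

lemma unit_pairs_swap: "bij_betw prod.swap (unit_pairs q N) (unit_pairs q N)"
  by (rule bij_betwI[where g = prod.swap]) (auto simp: unit_pairs_def)

lemma sum_unit_pairs_le: "(\<Sum>p\<in>unit_pairs q N. 1 / real (pair_prod p)) \<le> harm N ^ 2"
proof -
  let ?A = "{n\<in>{1..N}. coprime n q}"
  have "(\<Sum>p\<in>unit_pairs q N. 1 / real (pair_prod p)) = (\<Sum>a\<in>?A. 1 / real a) ^ 2"
    by (simp add: unit_pairs_def sum.cartesian_product' power2_eq_square sum_product)
  also have "(\<Sum>a\<in>?A. 1 / real a) \<le> (\<Sum>a\<in>{1..N}. 1 / real a)"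
    by (intro sum_mono2) auto
  hence "(\<Sum>a\<in>?A. 1 / real a) ^ 2 \<le> harm N ^ 2"
    by (intro power_mono sum_nonneg) (auto simp: harm_def inverse_eq_divide)
  finally show ?thesis .
qed

text \<open>Only the first entry of \<open>p\<close> is tested for size. The other three variables
  are reached by swapping the entries of a pair or exchanging the two pairs.\<close>

definition large_weight :: "nat \<Rightarrow> nat \<times> nat \<Rightarrow> nat \<times> nat \<Rightarrow> real" where
  "large_weight q p r =
     (if [pair_prod p = pair_prod r] (mod q) \<and> q < fst p ^ 2
      then 1 / (real (pair_prod p) * real (pair_prod r)) else 0)"

lemma large_weight_nonneg [simp]: "large_weight q p r \<ge> 0"
  by (simp add: large_weight_def)

text \<open>Once \<open>b\<close>, \<open>c\<close>, \<open>d\<close> are fixed, the variable \<open>a\<close> with \<open>a b \<equiv> c d\<close> runs through one residue class.\<close>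

lemma sum_large_weight_le:
  assumes q: "q > 0"
  shows "(\<Sum>p\<in>unit_pairs q N. \<Sum>r\<in>unit_pairs q N. large_weight q p r) \<le>
           harm N ^ 3 * (1 / sqrt (real q) + harm N / real q)"
proof -
  let ?A = "{n\<in>{1..N}. coprime n q}" and ?P = "unit_pairs q N"
  let ?K = "1 / sqrt (real q) + harm N / real q"
  have K: "?K \<ge> 0" by (intro add_nonneg_nonneg divide_nonneg_nonneg harm_nonneg) auto
  have H: "(\<Sum>b\<in>?A. 1 / real b) \<le> harm N"
    unfolding harm_def inverse_eq_divide by (intro sum_mono2) auto
  have inner: "(\<Sum>p\<in>?P. large_weight q p r) \<le> 1 / real (pair_prod r) * (harm N * ?K)" for r
  proof -
    have "(\<Sum>p\<in>?P. large_weight q p r) = (\<Sum>b\<in>?A. \<Sum>a\<in>?A. large_weight q (a, b) r)"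
      unfolding unit_pairs_def by (subst sum.swap) (simp add: sum.cartesian_product')
    also have "\<dots> \<le> (\<Sum>b\<in>?A. 1 / real (pair_prod r) * (1 / real b * ?K))"
    proof (intro sum_mono)
      fix b assume b: "b \<in> ?A"
      let ?X = "{a\<in>?A. [a * b = pair_prod r] (mod q) \<and> q < a ^ 2}"
      have "(\<Sum>a\<in>?A. large_weight q (a, b) r) = (\<Sum>a\<in>?X. large_weight q (a, b) r)"
        by (intro sum.mono_neutral_right) (auto simp: large_weight_def)
      also have "\<dots> = (\<Sum>a\<in>?X. 1 / real (pair_prod r) * (1 / real b * (1 / real a)))"
        by (intro sum.cong) (auto simp: large_weight_def)
      also have "\<dots> = 1 / real (pair_prod r) * (1 / real b * (\<Sum>a\<in>?X. 1 / real a))"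
        by (simp only: sum_distrib_left)
      also have "\<dots> \<le> 1 / real (pair_prod r) * (1 / real b * ?K)"
      proof (intro mult_left_mono sum_inverse_residue_class_le[OF q])
        fix a a' assume "a \<in> ?X" "a' \<in> ?X"
        hence "[a * b = a' * b] (mod q)" by (auto intro: cong_trans cong_sym)
        thus "[a = a'] (mod q)" using b by (simp add: cong_mult_rcancel_nat)
      qed auto
      finally show "(\<Sum>a\<in>?A. large_weight q (a, b) r) \<le> 1 / real (pair_prod r) * (1 / real b * ?K)" .
    qed
    also have "\<dots> = 1 / real (pair_prod r) * ((\<Sum>b\<in>?A. 1 / real b) * ?K)"
      by (simp only: sum_distrib_left sum_distrib_right)
    also have "\<dots> \<le> 1 / real (pair_prod r) * (harm N * ?K)"
      using K H by (intro mult_left_mono mult_right_mono) auto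
    finally show ?thesis .
  qed
  have "(\<Sum>p\<in>?P. \<Sum>r\<in>?P. large_weight q p r) = (\<Sum>r\<in>?P. \<Sum>p\<in>?P. large_weight q p r)"
    by (rule sum.swap)
  also have "\<dots> \<le> (\<Sum>r\<in>?P. 1 / real (pair_prod r) * (harm N * ?K))"
    by (intro sum_mono inner)
  also have "\<dots> = (\<Sum>r\<in>?P. 1 / real (pair_prod r)) * (harm N * ?K)"
    by (simp only: sum_distrib_right)
  also have "\<dots> \<le> harm N ^ 2 * (harm N * ?K)"
    using K by (intro mult_right_mono sum_unit_pairs_le mult_nonneg_nonneg harm_nonneg)
  finally show ?thesis by (simp add: power2_eq_square power3_eq_cube mult_ac)
qed

section \<open>Splitting into diagonal and off-diagonal terms\<close>

definition congruence_weight :: "nat \<Rightarrow> nat \<times> nat \<Rightarrow> nat \<times> nat \<Rightarrow> real" where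
  "congruence_weight q p r =
     (if [pair_prod p = pair_prod r] (mod q) then 1 / (real (pair_prod p) * real (pair_prod r)) else 0)"

text \<open>The cutoff at \<open>q\<close> matches the truncated main term; equal products above
  \<open>q\<close> are counted as error.\<close>

definition diagonal_weight :: "nat \<Rightarrow> nat \<times> nat \<Rightarrow> nat \<times> nat \<Rightarrow> real" where
  "diagonal_weight q p r =
     (if pair_prod p = pair_prod r \<and> pair_prod p \<le> q then 1 / (real (pair_prod p) * real (pair_prod r)) else 0)"

lemma diagonal_weight_le: "diagonal_weight q p r \<le> congruence_weight q p r"
  unfolding diagonal_weight_def congruence_weight_def by (simp del: of_nat_mult)

lemma cong_imp_eq_of_le:
  fixes x y q :: nat
  assumes "[x = y] (mod q)" "0 < x" "0 < y" "x \<le> q" "y \<le> q"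
  shows "x = y"
proof -
  have False if "[x = y] (mod q)" "x < y" "0 < x" "y \<le> q" for x y :: nat
  proof -
    have "q dvd y - x" using that cong_altdef_nat[of x y q] by (simp add: cong_sym_eq)
    hence "q \<le> y - x" using that by (intro dvd_imp_le) auto
    thus False using that by simp
  qed
  thus ?thesis using assms cong_sym by (metis linorder_neqE_nat)
qed

text \<open>Two distinct congruent numbers cannot both be at most \<open>q\<close>, and a product exceeding \<open>q\<close>
  has a factor exceeding \<open>sqrt q\<close>.\<close>

lemma congruence_weight_le:
  assumes "p \<in> unit_pairs q N" "r \<in> unit_pairs q N"
  shows "congruence_weight q p r \<le> diagonal_weight q p r +
           (large_weight q p r + large_weight q (prod.swap p) r +
            large_weight q r p + large_weight q (prod.swap r) p)"
proof (cases "[pair_prod p = pair_prod r] (mod q) \<and> \<not> (pair_prod p = pair_prod r \<and> pair_prod p \<le> q)")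
  case True
  have pos: "pair_prod p > 0" "pair_prod r > 0"
    using assms by (auto simp: unit_pairs_def)
  have "pair_prod p > q \<or> pair_prod r > q"
  proof (rule ccontr)
    assume "\<not> ?thesis"
    hence "pair_prod p = pair_prod r"
      using True pos by (intro cong_imp_eq_of_le[of _ _ q]) auto
    with True \<open>\<not> ?thesis\<close> show False by auto
  qed
  have large: "q < x ^ 2 \<or> q < y ^ 2" if "q < x * y" for x y :: nat
  proof (cases "x \<le> y")
    case True
    thus ?thesis using less_le_trans[OF that mult_le_mono1[of x y y]] by (simp add: power2_eq_square)
  next
    case False
    thus ?thesis using less_le_trans[OF that mult_le_mono2[of y x x]] by (simp add: power2_eq_square)
  qed
  have sym: "[pair_prod r = pair_prod p] (mod q)" using True by (simp add: cong_sym_eq)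
  have cw: "congruence_weight q p r = 1 / (real (pair_prod p) * real (pair_prod r))"
    using True by (simp add: congruence_weight_def)
  have dw: "diagonal_weight q p r \<ge> 0" by (simp add: diagonal_weight_def)
  have "large_weight q p r = congruence_weight q p r \<or> large_weight q (prod.swap p) r = congruence_weight q p r \<or>
        large_weight q r p = congruence_weight q p r \<or> large_weight q (prod.swap r) p = congruence_weight q p r"
    using \<open>pair_prod p > q \<or> pair_prod r > q\<close> large[of "fst p" "snd p"] large[of "fst r" "snd r"] True sym
    unfolding cw large_weight_def by (auto simp: mult_ac)
  with dw show ?thesis
    using large_weight_nonneg[of q p r] large_weight_nonneg[of q "prod.swap p" r]
      large_weight_nonneg[of q r p] large_weight_nonneg[of q "prod.swap r" p] by linarith
next
  case False
  hence "congruence_weight q p r \<le> diagonal_weight q p r"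
    by (auto simp: congruence_weight_def diagonal_weight_def)
  thus ?thesis
    using large_weight_nonneg[of q p r] large_weight_nonneg[of q "prod.swap p" r]
      large_weight_nonneg[of q r p] large_weight_nonneg[of q "prod.swap r" p] by linarith
qed

text \<open>The four sums of \<open>large_weight\<close> are equal, because swapping entries and
  exchanging the pairs preserve the range of summation.\<close>

lemma sum_congruence_weight:
  assumes q: "q > 0"
  shows "(\<Sum>p\<in>unit_pairs q N. \<Sum>r\<in>unit_pairs q N. congruence_weight q p r) \<le>
           (\<Sum>p\<in>unit_pairs q N. \<Sum>r\<in>unit_pairs q N. diagonal_weight q p r) +
           4 * (harm N ^ 3 * (1 / sqrt (real q) + harm N / real q))"
proof -
  let ?P = "unit_pairs q N"
  define E where "E = (\<Sum>p\<in>?P. \<Sum>r\<in>?P. large_weight q p r)"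
  have swap: "(\<Sum>p\<in>?P. f (prod.swap p)) = (\<Sum>p\<in>?P. f p)" for f :: "nat \<times> nat \<Rightarrow> real"
    by (rule sum.reindex_bij_betw[OF unit_pairs_swap])
  have E2: "(\<Sum>p\<in>?P. \<Sum>r\<in>?P. large_weight q (prod.swap p) r) = E"
    unfolding E_def by (rule swap)
  have E3: "(\<Sum>p\<in>?P. \<Sum>r\<in>?P. large_weight q r p) = E"
    unfolding E_def by (rule sum.swap)
  have E4: "(\<Sum>p\<in>?P. \<Sum>r\<in>?P. large_weight q (prod.swap r) p) = E"
    by (subst swap) (rule E3)
  have "(\<Sum>p\<in>?P. \<Sum>r\<in>?P. congruence_weight q p r) \<le>
          (\<Sum>p\<in>?P. \<Sum>r\<in>?P. diagonal_weight q p r +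
           (large_weight q p r + large_weight q (prod.swap p) r +
            large_weight q r p + large_weight q (prod.swap r) p))"
    by (intro sum_mono congruence_weight_le)
  also have "\<dots> = (\<Sum>p\<in>?P. \<Sum>r\<in>?P. diagonal_weight q p r) + 4 * E"
    by (simp only: sum.distrib E2 E3 E4) (simp add: E_def)
  finally show ?thesis using sum_large_weight_le[OF q, of N] unfolding E_def by linarith
qed

section \<open>The diagonal as a divisor sum, and a lower bound for the totient\<close>

lemma card_unit_pairs_eq_divisor_count:
  assumes "n \<in> {1..N}" "coprime n q"
  shows "card {p\<in>unit_pairs q N. pair_prod p = n} = divisor_count n"
proof -
  have "bij_betw fst {p\<in>unit_pairs q N. pair_prod p = n} {d. d dvd n}"
  proof (rule bij_betwI[where g = "\<lambda>d. (d, n div d)"])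
    show "(\<lambda>d. (d, n div d)) \<in> {d. d dvd n} \<rightarrow> {p\<in>unit_pairs q N. pair_prod p = n}"
    proof
      fix d assume "d \<in> {d. d dvd n}"
      then obtain e where e: "n = d * e" by auto
      hence "d > 0" "e > 0" using assms(1) by auto
      hence "d \<le> n" "e \<le> n" by (auto simp: e)
      thus "(d, n div d) \<in> {p\<in>unit_pairs q N. pair_prod p = n}"
        using assms \<open>d > 0\<close> \<open>e > 0\<close> order_trans[OF \<open>d \<le> n\<close>, of N] order_trans[OF \<open>e \<le> n\<close>, of N]
        by (auto simp: unit_pairs_def e)
    qed
  qed (use assms in \<open>auto simp: unit_pairs_def\<close>)
  thus ?thesis by (simp add: divisor_count_def bij_betw_same_card)
qed

text \<open>Sorted by the common product \<open>n\<close>, the pairs \<open>p\<close> and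
  \<open>r\<close> run independently over the factorisations of \<open>n\<close>. All of these lie
  in range because \<open>n \<le> q \<le> N\<close>.\<close>

lemma sum_diagonal_weight:
  assumes "q \<le> N"
  shows "(\<Sum>p\<in>unit_pairs q N. \<Sum>r\<in>unit_pairs q N. diagonal_weight q p r) =
           (\<Sum>n | n \<in> {1..q} \<and> coprime n q. real (divisor_count n) ^ 2 / real n ^ 2)"
proof -
  let ?P = "unit_pairs q N" and ?Q = "{n. n \<in> {1..q} \<and> coprime n q}"
  have fin: "finite ?Q" by simp
  have "(\<Sum>p\<in>?P. \<Sum>r\<in>?P. diagonal_weight q p r) =
          (\<Sum>p\<in>?P. \<Sum>r\<in>?P. \<Sum>n\<in>?Q. if pair_prod p = n \<and> pair_prod r = n then 1 / real n ^ 2 else 0)"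
  proof (intro sum.cong refl)
    fix p r assume p: "p \<in> ?P"
    have "(\<Sum>n\<in>?Q. if pair_prod p = n \<and> pair_prod r = n then 1 / real n ^ 2 else 0) =
            (\<Sum>n\<in>?Q. if pair_prod p = n then (if pair_prod r = n then 1 / real n ^ 2 else 0) else 0)"
      by (intro sum.cong) auto
    also have "\<dots> = (if pair_prod p \<in> ?Q then (if pair_prod r = pair_prod p then 1 / real (pair_prod p) ^ 2 else 0) else 0)"
      using fin by (rule sum.delta')
    also have "pair_prod p \<in> ?Q \<longleftrightarrow> pair_prod p \<le> q"
      using p by (auto simp: unit_pairs_def)
    finally show "diagonal_weight q p r =
        (\<Sum>n\<in>?Q. if pair_prod p = n \<and> pair_prod r = n then 1 / real n ^ 2 else 0)"
      by (auto simp: diagonal_weight_def power2_eq_square)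
  qed
  also have "\<dots> = (\<Sum>p\<in>?P. \<Sum>n\<in>?Q. \<Sum>r\<in>?P. if pair_prod p = n \<and> pair_prod r = n then 1 / real n ^ 2 else 0)"
    by (intro sum.cong refl sum.swap)
  also have "\<dots> = (\<Sum>n\<in>?Q. \<Sum>p\<in>?P. \<Sum>r\<in>?P. if pair_prod p = n \<and> pair_prod r = n then 1 / real n ^ 2 else 0)"
    by (rule sum.swap)
  also have "\<dots> = (\<Sum>n\<in>?Q. real (divisor_count n) ^ 2 / real n ^ 2)"
  proof (intro sum.cong refl)
    fix n assume n: "n \<in> ?Q"
    have ind: "(\<Sum>p\<in>?P. if pair_prod p = n then 1 else 0 :: real) = real (divisor_count n)"
      using card_unit_pairs_eq_divisor_count[of n N q] n assms
      by (simp add: sum.If_cases Int_def)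
    have "(\<Sum>p\<in>?P. \<Sum>r\<in>?P. if pair_prod p = n \<and> pair_prod r = n then 1 / real n ^ 2 else 0) =
          (\<Sum>p\<in>?P. \<Sum>r\<in>?P. (if pair_prod p = n then 1 else 0) * (if pair_prod r = n then 1 else 0)) / real n ^ 2"
      unfolding sum_divide_distrib by (intro sum.cong refl) auto
    also have "\<dots> = real (divisor_count n) ^ 2 / real n ^ 2"
      by (simp only: sum_product[symmetric] ind power2_eq_square)
    finally show "(\<Sum>p\<in>?P. \<Sum>r\<in>?P. if pair_prod p = n \<and> pair_prod r = n then 1 / real n ^ 2 else 0) =
        real (divisor_count n) ^ 2 / real n ^ 2" .
  qed
  finally show ?thesis .
qed

text \<open>The bound is checked prime by prime: \<open>p \<le> (p - 1) ^ 2\<close> for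
  \<open>p \<ge> 3\<close>, while \<open>p = 2\<close> loses a factor 2, and only once.\<close>

lemma totient_square_ge: "n \<le> 2 * totient n ^ 2"
proof (cases "n = 0")
  case False
  \<comment> \<open>The loss factor at \<open>p\<close>, whose product over all prime factors is at
    most 2.\<close>
  define e where "e p = (if p = 2 then 2 else 1 :: nat)" for p :: nat
  have "n = (\<Prod>p\<in>prime_factors n. p ^ multiplicity p n)"
    using False by (intro prime_factorization_nat) simp
  also have "\<dots> \<le> (\<Prod>p\<in>prime_factors n. e p * (p ^ (multiplicity p n - 1) * (p - 1)) ^ 2)"
  proof (intro prod_mono conjI)
    fix p assume p: "p \<in> prime_factors n"
    hence m: "multiplicity p n > 0" and pp: "p \<ge> 2"
      by (auto simp: prime_factors_multiplicity prime_ge_2_nat)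
    have "p \<le> e p * (p - 1) ^ 2"
    proof (cases "p = 2")
      case False
      hence "p = (p - 3) + 3" using pp by simp
      then obtain t where "p = t + 3" by blast
      thus ?thesis by (simp add: e_def power2_eq_square algebra_simps)
    qed (simp add: e_def)
    moreover have "p ^ (multiplicity p n - 1) \<le> (p ^ (multiplicity p n - 1)) ^ 2"
      using pp by (intro self_le_power) auto
    ultimately have "p * p ^ (multiplicity p n - 1) \<le>
        (e p * (p - 1) ^ 2) * (p ^ (multiplicity p n - 1)) ^ 2"
      by (intro mult_mono) auto
    thus "p ^ multiplicity p n \<le> e p * (p ^ (multiplicity p n - 1) * (p - 1)) ^ 2"
      using m by (simp add: power_eq_if power_mult_distrib mult_ac)
  qed auto
  also have "\<dots> = (\<Prod>p\<in>prime_factors n. e p) * totient n ^ 2"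
    using False by (simp add: totient_formula1 prod.distrib prod_power_distrib power_mult_distrib)
  also have "(\<Prod>p\<in>prime_factors n. e p) = (if 2 \<in> prime_factors n then 2 else 1)"
    unfolding e_def by (rule prod.delta) simp
  also have "\<dots> \<le> 2" by simp
  finally show ?thesis by simp
qed simp

section \<open>The fourth moment\<close>

text \<open>The fourth power of the modulus is the square \<open>S * S\<close> times its conjugate.
  Expanding both over pairs and summing over characters first, orthogonality selects congruent
  products.\<close>

lemma fourth_moment_partial_sums:
  assumes q: "q > 0"
  shows "(\<Sum>chi | dirichlet_character q chi. norm (\<Sum>n=1..N. chi n / of_nat n) ^ 4) =
           real (totient q) * (\<Sum>p\<in>unit_pairs q N. \<Sum>r\<in>unit_pairs q N. congruence_weight q p r)"
proof -
  let ?A = "{n\<in>{1..N}. coprime n q}" and ?P = "unit_pairs q N"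
  let ?X = "{chi. dirichlet_character q chi}"
  define w where "w p = 1 / complex_of_nat (pair_prod p)" for p
  have expand: "of_real (norm (\<Sum>n=1..N. chi n / of_nat n) ^ 4) =
      (\<Sum>p\<in>?P. \<Sum>r\<in>?P. w p * w r * (chi (pair_prod p) * cnj (chi (pair_prod r))))"
    if chi: "dirichlet_character q chi" for chi
  proof -
    define S where "S = (\<Sum>n=1..N. chi n / of_nat n)"
    have "S = (\<Sum>a\<in>?A. chi a / of_nat a)"
      unfolding S_def by (intro sum.mono_neutral_right) (auto simp: dirichlet_character_eq_0_iff[OF chi])
    hence SS: "S * S = (\<Sum>p\<in>?P. w p * chi (pair_prod p))"
      by (simp add: unit_pairs_def sum.cartesian_product' sum_product w_def dirichlet_character_mult[OF chi])
    have "complex_of_real (norm S ^ 4) = of_real (norm (S * S)) ^ 2"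
      by (simp add: norm_mult power2_eq_square power4_eq_xxxx mult.assoc)
    also have "\<dots> = (S * S) * cnj (S * S)"
      by (simp only: complex_norm_square[symmetric] of_real_power)
    also have "\<dots> = (\<Sum>p\<in>?P. \<Sum>r\<in>?P. w p * w r * (chi (pair_prod p) * cnj (chi (pair_prod r))))"
      unfolding SS cnj_sum sum_product by (intro sum.cong refl) (simp add: w_def)
    finally show ?thesis by (simp add: S_def)
  qed
  have "complex_of_real (\<Sum>chi\<in>?X. norm (\<Sum>n=1..N. chi n / of_nat n) ^ 4) =
      (\<Sum>chi\<in>?X. \<Sum>p\<in>?P. \<Sum>r\<in>?P. w p * w r * (chi (pair_prod p) * cnj (chi (pair_prod r))))"
    unfolding of_real_sum using expand by (intro sum.cong) auto
  also have "\<dots> = (\<Sum>p\<in>?P. \<Sum>chi\<in>?X. \<Sum>r\<in>?P. w p * w r * (chi (pair_prod p) * cnj (chi (pair_prod r))))"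
    by (rule sum.swap)
  also have "\<dots> = (\<Sum>p\<in>?P. \<Sum>r\<in>?P. w p * w r * (\<Sum>chi\<in>?X. chi (pair_prod p) * cnj (chi (pair_prod r))))"
    unfolding sum_distrib_left by (intro sum.cong refl sum.swap)
  also have "\<dots> = (\<Sum>p\<in>?P. \<Sum>r\<in>?P. of_real (real (totient q) * congruence_weight q p r))"
  proof (intro sum.cong refl)
    fix p r assume "r \<in> ?P"
    hence "coprime (pair_prod r) q" by (auto simp: unit_pairs_def)
    thus "w p * w r * (\<Sum>chi\<in>?X. chi (pair_prod p) * cnj (chi (pair_prod r))) =
            of_real (real (totient q) * congruence_weight q p r)"
      by (simp add: dirichlet_characters_orthogonal[OF q] w_def congruence_weight_def)
  qed
  also have "\<dots> = complex_of_real (real (totient q) * (\<Sum>p\<in>?P. \<Sum>r\<in>?P. congruence_weight q p r))"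
    by (simp add: sum_distrib_left)
  finally show ?thesis by (simp only: of_real_eq_iff)
qed

section \<open>Passing from partial sums to \<open>L\<close>-values and collecting the
  errors\<close>

lemma card_dirichlet_characters:
  assumes "q > 0"
  shows "card {chi. dirichlet_character q chi} = totient q"
proof -
  have "complex_of_nat (totient q) = (\<Sum>chi | dirichlet_character q chi. chi 1)"
    using sum_over_dirichlet_characters[OF assms, of 1] by simp
  also have "\<dots> = (\<Sum>chi | dirichlet_character q chi. 1)"
    by (intro sum.cong) (auto simp: dirichlet_character_1)
  finally show ?thesis by simp
qed

lemma abs_power4_diff_le:
  fixes x y :: real
  assumes "\<bar>x - y\<bar> \<le> e" "0 \<le> x" "x \<le> M" "0 \<le> y" "y \<le> M"
  shows "\<bar>x ^ 4 - y ^ 4\<bar> \<le> 4 * M ^ 3 * e"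
proof -
  have "x ^ 4 - y ^ 4 = (x - y) * (x ^ 3 + x ^ 2 * y + x * y ^ 2 + y ^ 3)"
    by (simp add: algebra_simps power4_eq_xxxx power3_eq_cube power2_eq_square)
  moreover have "x ^ 3 + x ^ 2 * y + x * y ^ 2 + y ^ 3 \<le> M ^ 3 + M ^ 2 * M + M * M ^ 2 + M ^ 3"
    using assms by (intro add_mono mult_mono power_mono) auto
  moreover have "0 \<le> x ^ 3 + x ^ 2 * y + x * y ^ 2 + y ^ 3"
    using assms by simp
  ultimately have "\<bar>x ^ 4 - y ^ 4\<bar> \<le> e * (M ^ 3 + M ^ 2 * M + M * M ^ 2 + M ^ 3)"
    using assms by (auto simp: abs_mult intro!: mult_mono)
  thus ?thesis by (simp add: power2_eq_square power3_eq_cube mult_ac)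
qed

lemma norm_partial_L_1_le:
  assumes "dirichlet_character q chi" "q > 0"
  shows "norm (\<Sum>n=1..N. chi n / of_nat n) \<le> harm N"
  unfolding harm_def
  by (intro sum_norm_le)
     (use norm_dirichlet_character[OF assms] in \<open>auto simp: norm_divide inverse_eq_divide\<close>)

text \<open>Truncation at \<open>q\<^sup>2\<close> makes the error \<open>2 / q\<close>, at most
  \<open>1 \<le> H\<close>; hence both moduli are at most \<open>2 * H\<close>.\<close>

lemma norm_L_1_power4_diff_le:
  assumes chi: "dirichlet_character q chi" "chi \<noteq> principal_character q" and q: "q \<ge> 2"
    and H: "H = harm (q ^ 2)"
  shows "\<bar>norm (dirichlet_L q chi 1) ^ 4 - norm (\<Sum>n=1..q\<^sup>2. chi n / of_nat n) ^ 4\<bar> \<le> 64 * H ^ 3 / real q"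
proof -
  let ?L = "dirichlet_L q chi 1" and ?S = "\<Sum>n=1..q\<^sup>2. chi n / of_nat n"
  have "norm (?L - ?S) \<le> 2 * real q / real (q ^ 2 + 1)"
    using q by (intro dirichlet_L_1_approx chi) auto
  also have "\<dots> \<le> 2 * real q / real (q ^ 2)"
    using q by (intro frac_le) auto
  also have "\<dots> = 2 / real q" by (simp add: power2_eq_square)
  finally have LS: "norm (?L - ?S) \<le> 2 / real q" .
  hence d: "\<bar>norm ?L - norm ?S\<bar> \<le> 2 / real q"
    using norm_triangle_ineq3[of ?L ?S] by linarith
  have S: "norm ?S \<le> H"
    unfolding H using q by (intro norm_partial_L_1_le[OF chi(1)]) simp
  have H1: "H \<ge> 1"
    unfolding H harm_def using q member_le_sum[of 1 "{1..q ^ 2}" "\<lambda>k. inverse (real k)"] by simp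
  have "2 / real q \<le> 1" using q by simp
  hence "norm ?L \<le> 2 * H" using d S H1 by linarith
  \<comment> \<open>The constant 64 is \<open>4 * 8 * 2\<close>.\<close>
  hence "\<bar>norm ?L ^ 4 - norm ?S ^ 4\<bar> \<le> 4 * (2 * H) ^ 3 * (2 / real q)"
    using S H1 by (intro abs_power4_diff_le d) auto
  thus ?thesis by (simp add: power_mult_distrib)
qed

text \<open>The constant 74 is \<open>64 + 8 + 2\<close>: 64 for replacing \<open>L\<close>-values
  by partial sums, 8 for the off-diagonal terms, and 2 for the principal character, which the
  complete moment includes.\<close>

lemma fourth_moment_L_1_error:
  fixes q :: nat
  defines "H \<equiv> harm (q ^ 2)"
  assumes q: "q \<ge> 2"
  shows "\<bar>(\<Sum>chi | dirichlet_character q chi \<and> chi \<noteq> principal_character q. norm (dirichlet_L q chi 1) ^ 4)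
      - real (totient q) * (\<Sum>n | n \<in> {1..q} \<and> coprime n q. real (divisor_count n) ^ 2 / real n ^ 2)\<bar>
     \<le> 74 * (real (totient q) / sqrt (real q)) * H ^ 4"
proof -
  define phi where "phi = real (totient q)"
  define D where "D = (\<Sum>n | n \<in> {1..q} \<and> coprime n q. real (divisor_count n) ^ 2 / real n ^ 2)"
  define T where "T = phi / sqrt (real q) * H ^ 4"
  define S where "S chi = (\<Sum>n=1..q\<^sup>2. chi n / of_nat n)" for chi :: "nat \<Rightarrow> complex"
  let ?P = "unit_pairs q (q ^ 2)" and ?chi0 = "principal_character q"
  let ?X = "{chi. dirichlet_character q chi}"
  let ?X' = "{chi. dirichlet_character q chi \<and> chi \<noteq> ?chi0}"
  have q0: "q > 0" using q by simp
  have phi: "phi \<ge> 0" by (simp add: phi_def)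
  have sq: "sqrt (real q) > 0" "sqrt (real q) \<le> real q"
    using q real_sqrt_le_mono[of "real q" "real q ^ 2"] by (auto simp: power2_eq_square)
  have H1: "H \<ge> 1"
    unfolding H_def harm_def using q member_le_sum[of 1 "{1..q ^ 2}" "\<lambda>k. inverse (real k)"] by simp
  have H34: "H ^ 3 \<le> H ^ 4" using H1 by (intro power_increasing) auto
  have finX: "finite ?X" by (rule finite_dirichlet_characters[OF q0])
  have X': "?X' = ?X - {?chi0}" by auto
  have split: "(\<Sum>chi\<in>?X. norm (S chi) ^ 4) = norm (S ?chi0) ^ 4 + (\<Sum>chi\<in>?X'. norm (S chi) ^ 4)"
    unfolding X' using finX dirichlet_character_principal by (intro sum.remove) auto

  have "\<bar>(\<Sum>chi\<in>?X'. norm (dirichlet_L q chi 1) ^ 4) - (\<Sum>chi\<in>?X'. norm (S chi) ^ 4)\<bar> \<le>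
          (\<Sum>chi\<in>?X'. \<bar>norm (dirichlet_L q chi 1) ^ 4 - norm (S chi) ^ 4\<bar>)"
    unfolding sum_subtractf[symmetric] by (rule sum_abs)
  also have "\<dots> \<le> (\<Sum>chi\<in>?X'. 64 * H ^ 3 / real q)"
    unfolding S_def by (intro sum_mono norm_L_1_power4_diff_le q) (auto simp: H_def)
  also have "\<dots> = real (card ?X') * (64 * H ^ 3 / real q)" by simp
  \<comment> \<open>There are at most \<open>phi\<close> characters; \<open>H \<ge> 1\<close> and
    \<open>sqrt q \<le> q\<close> bring the error to the common shape \<open>T\<close>.\<close>
  also have "\<dots> \<le> phi * (64 * H ^ 4 / sqrt (real q))"
  proof (intro mult_mono frac_le)
    have "card ?X' \<le> card ?X" by (intro card_mono finX) auto
    thus "real (card ?X') \<le> phi" by (simp add: card_dirichlet_characters[OF q0] phi_def)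
  qed (use H1 H34 sq phi in auto)
  also have "\<dots> = 64 * T" by (simp add: T_def)
  finally have e1: "\<bar>(\<Sum>chi\<in>?X'. norm (dirichlet_L q chi 1) ^ 4) - (\<Sum>chi\<in>?X'. norm (S chi) ^ 4)\<bar> \<le> 64 * T" .

  define W where "W = (\<Sum>p\<in>?P. \<Sum>r\<in>?P. congruence_weight q p r)"
  have diag: "(\<Sum>p\<in>?P. \<Sum>r\<in>?P. diagonal_weight q p r) = D"
    unfolding D_def using q by (intro sum_diagonal_weight) (simp add: power2_eq_square)
  have W1: "D \<le> W"
    unfolding diag[symmetric] W_def by (intro sum_mono diagonal_weight_le)
  have "W \<le> D + 4 * (H ^ 3 * (1 / sqrt (real q) + H / real q))"
    using sum_congruence_weight[OF q0, of "q ^ 2"] by (simp only: diag W_def H_def)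
  also have "1 / sqrt (real q) + H / real q \<le> H / sqrt (real q) + H / sqrt (real q)"
    using H1 sq by (intro add_mono frac_le) auto
  hence "D + 4 * (H ^ 3 * (1 / sqrt (real q) + H / real q)) \<le>
           D + 4 * (H ^ 3 * (H / sqrt (real q) + H / sqrt (real q)))"
    using H1 by (intro add_left_mono mult_left_mono) auto
  also have "H ^ 3 * (H / sqrt (real q) + H / sqrt (real q)) = 2 * (H ^ 4 / sqrt (real q))"
    by (simp add: power3_eq_cube power4_eq_xxxx)
  finally have "W - D \<le> 8 * (H ^ 4 / sqrt (real q))" by simp
  hence "phi * (W - D) \<le> phi * (8 * (H ^ 4 / sqrt (real q)))"
    using phi by (rule mult_left_mono)
  hence W2: "phi * W - phi * D \<le> 8 * T" by (simp add: T_def right_diff_distrib mult_ac)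
  have W3: "0 \<le> phi * W - phi * D" using W1 phi by (simp add: mult_left_mono)
  have moment: "(\<Sum>chi\<in>?X. norm (S chi) ^ 4) = phi * W"
    unfolding S_def phi_def W_def by (rule fourth_moment_partial_sums[OF q0])

  \<comment> \<open>The principal character contributes at most \<open>H ^ 4\<close>, without a
    factor of its own, so \<open>phi / sqrt q\<close> must be bounded below, here by one
    half.\<close>
  have "real q \<le> real (2 * totient q ^ 2)"
    unfolding of_nat_le_iff by (rule totient_square_ge)
  also have "\<dots> \<le> (2 * phi) ^ 2" by (simp add: phi_def power2_eq_square)
  finally have "sqrt (real q) \<le> 2 * phi" using phi by (intro real_le_lsqrt) auto
  hence "1 \<le> 2 * (phi / sqrt (real q))" using sq by (simp add: field_simps)
  hence "1 * H ^ 4 \<le> 2 * (phi / sqrt (real q)) * H ^ 4"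
    using H1 by (intro mult_right_mono) auto
  moreover have "norm (S ?chi0) ^ 4 \<le> H ^ 4"
    unfolding S_def H_def
    by (intro power_mono norm_partial_L_1_le[OF dirichlet_character_principal q0] norm_ge_zero)
  ultimately have e3: "norm (S ?chi0) ^ 4 \<le> 2 * T" by (simp add: T_def)
  have "norm (S ?chi0) ^ 4 \<ge> 0" by simp
  hence "\<bar>(\<Sum>chi\<in>?X'. norm (dirichlet_L q chi 1) ^ 4) - phi * D\<bar> \<le> 74 * T"
    using e1 W2 W3 split moment e3 by linarith
  thus ?thesis by (simp add: T_def phi_def D_def)
qed

theorem theorem1:
  "\<exists>C::real. C > 0 \<and> (\<forall>q::nat. q \<ge> 3 \<longrightarrow>
     \<bar>(\<Sum>chi | dirichlet_character q chi \<and> chi \<noteq> principal_character q.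
          norm (dirichlet_L q chi 1) ^ 4)
      - real (totient q) *
          (\<Sum>n | n \<in> {1..q} \<and> coprime n q. real (divisor_count n) ^ 2 / real n ^ 2)\<bar>
     \<le> C * (real (totient q) / sqrt (real q)) * ln (real q + 2) ^ 4)"
\<comment> \<open>The factor 81 is \<open>3 ^ 4\<close>, from the bound
  \<open>harm (q ^ 2) \<le> 3 * ln (real q + 2)\<close>.\<close>
proof (intro exI[of _ "74 * 81"] conjI allI impI)
  fix q :: nat assume q: "q \<ge> 3"
  \<comment> \<open>This makes the logarithm at least 1, so it absorbs the summand 1 in the harmonic
    bound.\<close>
  have "exp (1::real) \<le> real q + 2" using exp_le q by linarith
  hence ln1: "1 \<le> ln (real q + 2)" using q by (simp add: ln_ge_iff)
  have "harm (q ^ 2) \<le> 1 + ln (real (q ^ 2))"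
    using q by (intro harm_le_1_plus_ln) simp
  also have "ln (real (q ^ 2)) = 2 * ln (real q)"
    using q by (simp add: ln_realpow)
  also have "ln (real q) \<le> ln (real q + 2)" using q by simp
  finally have "harm (q ^ 2) \<le> 3 * ln (real q + 2)" using ln1 by simp
  hence "harm (q ^ 2) ^ 4 \<le> (3 * ln (real q + 2)) ^ 4"
    by (intro power_mono harm_nonneg)
  hence "74 * (real (totient q) / sqrt (real q)) * harm (q ^ 2) ^ 4 \<le>
           74 * (real (totient q) / sqrt (real q)) * (81 * ln (real q + 2) ^ 4)"
    by (intro mult_left_mono) (auto simp: power_mult_distrib)
  also have "\<dots> = 74 * 81 * (real (totient q) / sqrt (real q)) * ln (real q + 2) ^ 4"
    by simp
  finally show "\<bar>(\<Sum>chi | dirichlet_character q chi \<and> chi \<noteq> principal_character q.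
          norm (dirichlet_L q chi 1) ^ 4)
      - real (totient q) *
          (\<Sum>n | n \<in> {1..q} \<and> coprime n q. real (divisor_count n) ^ 2 / real n ^ 2)\<bar>
     \<le> 74 * 81 * (real (totient q) / sqrt (real q)) * ln (real q + 2) ^ 4"
    using fourth_moment_L_1_error[of q] q by simp
qed simp

end
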